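(* Let $P$ be the uniform probability distribution on the equilateral triangle with vertices $(0,0)$, $(1,0)$, $(\frac12,\frac{\sqrt3}{2})$. Then the set $\{(\frac{7}{24},\frac{7}{24\sqrt3}),\ (\frac{17}{24},\frac{7}{24\sqrt3}),\ (\frac12,\frac{11}{12\sqrt3})\}$ is the only optimal set of three-means for $P$. The three points of this set form an equilateral triangle whose sides are parallel to the sides of the original triangle.
   Context: For a Borel probability measure $P$ on $\mathbb R^2$ with finite second moment and $n\ge1$, the $n$th quantization error is $V_n(P)=\inf\{\int \min_{a\in\alpha}\|x-a\|^2\,dP(x): \alpha\subset\mathbb R^2,\ \mathrm{card}(\alpha)\le n\}$, where $\|\cdot\|$ is the Euclidean norm. A set $\alpha$ with $\mathrm{card}(\alpha)\le n$ attaining this infimum is called an optimal set of $n$-means. The uniform distribution on the triangle has density $\frac{4}{\sqrt3}$ on the triangle and $0$ elsewhere. *)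

theory Defs
  imports "HOL-Analysis.Analysis"
begin

text \<open>Points of the plane are pairs of reals; the norm on real \<times> real is Euclidean.\<close>

definition tri :: "(real \<times> real) set" where
  "tri = convex hull {(0,0), (1,0), (1/2, sqrt 3 / 2)}"

definition tri_uniform :: "(real \<times> real) measure" where
  "tri_uniform = density lborel (\<lambda>x. ennreal (4 / sqrt 3 * indicator tri x))"

definition distortion :: "(real \<times> real) measure \<Rightarrow> (real \<times> real) set \<Rightarrow> ennreal" where
  "distortion P \<alpha> = (\<integral>\<^sup>+ x. ennreal ((Min ((\<lambda>a. norm (x - a)) ` \<alpha>))\<^sup>2) \<partial>P)"

definition admissible :: "nat \<Rightarrow> (real \<times> real) set \<Rightarrow> bool" where
  "admissible n \<alpha> \<longleftrightarrow> finite \<alpha> \<and> \<alpha> \<noteq> {} \<and> card \<alpha> \<le> n"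

definition quant_error :: "(real \<times> real) measure \<Rightarrow> nat \<Rightarrow> ennreal" where
  "quant_error P n = (INF \<alpha> \<in> {\<alpha>. admissible n \<alpha>}. distortion P \<alpha>)"

definition optimal_set :: "(real \<times> real) measure \<Rightarrow> nat \<Rightarrow> (real \<times> real) set \<Rightarrow> bool" where
  "optimal_set P n \<alpha> \<longleftrightarrow> admissible n \<alpha> \<and> distortion P \<alpha> = quant_error P n"

definition parallel :: "real \<times> real \<Rightarrow> real \<times> real \<Rightarrow> bool" where
  "parallel v w \<longleftrightarrow> (\<exists>c. v = c *\<^sub>R w)"

end

theory Submission
  imports Defs
begin

text \<open>
  The proof is by linear programming duality. Let \<open>g(x)\<close> be the mean of the squared distances from \<open>x\<close> to
  the nearest and the second nearest of the three claimed centers. For every finite set \<open>\<alpha>\<close> and every point,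
  \<open>g(x) \<le> min\<^sub>a |x - a|\<^sup>2 + (\<Sum>a\<in>\<alpha>. max 0 (g(x) - |x - a|\<^sup>2))\<close>, with equality for the claimed centers, so it
  suffices that the overlap \<open>\<Theta>(a) = E max 0 (g(x) - |x - a|\<^sup>2)\<close>, a function of a single point of the plane, is
  maximal exactly at the three centers. In barycentric coordinates \<open>g(x) - |x - a|\<^sup>2\<close> is affine plus a multiple
  of the smallest coordinate. The mean of its positive part is bounded by cutting the triangle into pieces on
  which the function is an affine \<open>v\<close> and using, depending on \<open>a\<close>, integration over the whole wedge at a
  vertex (sharp at the centers), integration over a half strip, \<open>4 k max 0 v \<le> (v + k)\<^sup>2\<close>, or the values of
  \<open>v\<close> at the vertices.
\<close>

section \<open>Means over barycentric coordinates\<close>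

text \<open>Any function between the squared distances to the nearest and the second nearest center
  gives equality for the centers, because then only the nearest center contributes to the sum. Where
  it lies strictly between, the set on which it exceeds |x - a|^2 for a center a is, up to a null
  set, the Voronoi cell of a; since a is the centroid of that cell, it is a critical point of
  \<Theta>. The mean of the two is convenient because nearest plus second nearest is the sum of all
  three minus the farthest, so the affine pieces are separated only by which barycentric coordinate
  is smallest. The obstacle is that \<Theta> must be bounded on the whole plane, while its exact
  value depends on how the zero set of the function cuts the triangle. The maximum is attained only
  at the centers, so a sharp estimate is needed only around them and cruder ones suffice elsewhere.
  After scaling by 432 the maximum of \<Theta> is 10. Strictness away from the centers yields
  uniqueness.\<close>

lemma nn_integral_plane_affine:
  fixes f :: "real \<times> real \<Rightarrow> ennreal"
  assumes [measurable]: "f \<in> borel_measurable borel" and "a \<noteq> 0" "d \<noteq> 0"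
  shows "(\<integral>\<^sup>+z. f z \<partial>lborel)
    = ennreal \<bar>a * d\<bar> * (\<integral>\<^sup>+z. f (e + a * fst z + b * snd z, h + d * snd z) \<partial>lborel)"
proof -
  have m: "f \<in> borel_measurable (lborel \<Otimes>\<^sub>M lborel)"
    by (simp add: lborel_prod)
  have [measurable]: "f \<in> borel_measurable (borel \<Otimes>\<^sub>M borel)"
    by (simp add: borel_prod)
  have m': "(\<lambda>z. f (e + a * fst z + b * snd z, h + d * snd z)) \<in> borel_measurable (lborel \<Otimes>\<^sub>M lborel)"
    by measurable
  have "(\<integral>\<^sup>+z. f z \<partial>lborel) = (\<integral>\<^sup>+y. \<integral>\<^sup>+x. f (x, y) \<partial>lborel \<partial>lborel)"
    by (simp add: lborel_pair.nn_integral_snd[OF m] lborel_prod)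
  also have "\<dots> = (\<integral>\<^sup>+y. ennreal \<bar>a\<bar> * (\<integral>\<^sup>+x. f (e + b * ((y - h) / d) + a * x, y) \<partial>lborel) \<partial>lborel)"
    by (intro nn_integral_cong nn_integral_real_affine) (use assms in \<open>measurable\<close>)
  also have "\<dots> = ennreal \<bar>a\<bar> * (\<integral>\<^sup>+y. (\<integral>\<^sup>+x. f (e + b * ((y - h) / d) + a * x, y) \<partial>lborel) \<partial>lborel)"
    by (rule nn_integral_cmult) measurable
  also have "(\<integral>\<^sup>+y. (\<integral>\<^sup>+x. f (e + b * ((y - h) / d) + a * x, y) \<partial>lborel) \<partial>lborel)
     = ennreal \<bar>d\<bar> * (\<integral>\<^sup>+y. (\<integral>\<^sup>+x. f (e + b * (((h + d * y) - h) / d) + a * x, h + d * y) \<partial>lborel) \<partial>lborel)"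
    by (rule nn_integral_real_affine) (use assms in \<open>measurable\<close>)
  also have "(\<integral>\<^sup>+y. (\<integral>\<^sup>+x. f (e + b * (((h + d * y) - h) / d) + a * x, h + d * y) \<partial>lborel) \<partial>lborel)
     = (\<integral>\<^sup>+y. \<integral>\<^sup>+x. (\<lambda>z. f (e + a * fst z + b * snd z, h + d * snd z)) (x, y) \<partial>lborel \<partial>lborel)"
    using \<open>d \<noteq> 0\<close> by (simp add: algebra_simps)
  also have "\<dots> = (\<integral>\<^sup>+z. f (e + a * fst z + b * snd z, h + d * snd z) \<partial>lborel)"
    unfolding lborel_pair.nn_integral_snd[OF m'] by (simp add: lborel_prod)
  finally show ?thesis
    by (simp add: abs_mult ennreal_mult' mult.assoc)
qed

lemma nn_integral_plane_swap:
  fixes f :: "real \<times> real \<Rightarrow> ennreal"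
  assumes "f \<in> borel_measurable borel"
  shows "(\<integral>\<^sup>+z. f z \<partial>lborel) = (\<integral>\<^sup>+z. f (snd z, fst z) \<partial>lborel)"
proof -
  have m: "f \<in> borel_measurable (lborel \<Otimes>\<^sub>M lborel)"
    using assms by (simp add: lborel_prod)
  have [measurable]: "f \<in> borel_measurable (borel \<Otimes>\<^sub>M borel)"
    using assms by (simp add: borel_prod)
  have m': "(\<lambda>z. f (snd z, fst z)) \<in> borel_measurable (lborel \<Otimes>\<^sub>M lborel)"
    by measurable
  have "(\<integral>\<^sup>+z. f z \<partial>lborel) = (\<integral>\<^sup>+y. \<integral>\<^sup>+x. f (x, y) \<partial>lborel \<partial>lborel)"
    by (simp add: lborel_pair.nn_integral_snd[OF m] lborel_prod)
  also have "\<dots> = (\<integral>\<^sup>+z. f (snd z, fst z) \<partial>lborel)"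
    using lborel.nn_integral_fst[OF m'] by (simp add: lborel_prod)
  finally show ?thesis .
qed

section \<open>The uniform distribution on the standard simplex, its symmetries and
  subdivisions\<close>

definition simplex_set :: "(real \<times> real) set" where
  "simplex_set = {z. 0 \<le> fst z \<and> 0 \<le> snd z \<and> fst z + snd z \<le> 1}"

text \<open>The simplex has area 1/2, so the factor 2 turns the integral into an expectation. The
  first barycentric coordinate is the dependent one.\<close>

definition simplex_mean :: "(real \<Rightarrow> real \<Rightarrow> real \<Rightarrow> ennreal) \<Rightarrow> ennreal" where
  "simplex_mean F =
    (\<integral>\<^sup>+z. 2 * F (1 - fst z - snd z) (fst z) (snd z) * indicator simplex_set z \<partial>lborel)"

abbreviation measurable3 :: "(real \<Rightarrow> real \<Rightarrow> real \<Rightarrow> ennreal) \<Rightarrow> bool" where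
  "measurable3 F \<equiv> (\<lambda>v. F (fst v) (fst (snd v)) (snd (snd v))) \<in> borel_measurable borel"

lemma measurable3_compose:
  assumes F: "measurable3 F"
    and [measurable]: "f \<in> borel_measurable M" "g \<in> borel_measurable M" "h \<in> borel_measurable M"
  shows "(\<lambda>z. F (f z) (g z) (h z)) \<in> borel_measurable M"
proof -
  have [measurable]: "(\<lambda>z. (f z, g z, h z)) \<in> measurable M borel"
    by (simp add: borel_prod[symmetric])
  from measurable_compose[OF this F] show ?thesis by simp
qed

lemma simplex_set_measurable [measurable]: "simplex_set \<in> sets borel"
proof -
  have "simplex_set = {z. 0 \<le> fst z} \<inter> {z. 0 \<le> snd z} \<inter> {z. fst z + snd z \<le> 1}"
    by (auto simp: simplex_set_def)
  also have "closed \<dots>"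
    by (intro closed_Int closed_Collect_le continuous_intros)
  finally show ?thesis by (rule borel_closed)
qed

lemma plane_projections_measurable [measurable]:
  "fst \<in> borel_measurable (borel :: (real \<times> real) measure)"
  "snd \<in> borel_measurable (borel :: (real \<times> real) measure)"
  by (auto intro!: borel_measurable_continuous_onI continuous_intros)

lemma simplex_mean_integrand_measurable:
  assumes "measurable3 F"
  shows "(\<lambda>z. 2 * F (1 - fst z - snd z) (fst z) (snd z) * indicator simplex_set z) \<in> borel_measurable borel"
proof -
  have [measurable]: "(\<lambda>z. F (1 - fst z - snd z) (fst z) (snd z)) \<in> borel_measurable borel"
    by (rule measurable3_compose[OF assms]) measurable
  show ?thesis by measurable
qed

lemma simplex_mean_cong:
  assumes "\<And>x y z. 0 \<le> x \<Longrightarrow> 0 \<le> y \<Longrightarrow> 0 \<le> z \<Longrightarrow> x + y + z = 1 \<Longrightarrow> F x y z = G x y z"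
  shows "simplex_mean F = simplex_mean G"
  unfolding simplex_mean_def
  by (rule nn_integral_cong) (auto simp: simplex_set_def indicator_def intro!: arg_cong2[where f="(*)"] assms)

lemma simplex_mean_mono:
  assumes "\<And>x y z. 0 \<le> x \<Longrightarrow> 0 \<le> y \<Longrightarrow> 0 \<le> z \<Longrightarrow> x + y + z = 1 \<Longrightarrow> F x y z \<le> G x y z"
  shows "simplex_mean F \<le> simplex_mean G"
  unfolding simplex_mean_def
  by (rule nn_integral_mono) (auto simp: simplex_set_def indicator_def intro!: mult_left_mono assms)

lemma simplex_mean_swap12:
  assumes F: "measurable3 F"
  shows "simplex_mean F = simplex_mean (\<lambda>x y z. F y x z)"
  unfolding simplex_mean_def
  by (subst nn_integral_plane_affine[OF simplex_mean_integrand_measurable[OF F], where a="-1" and b="-1" and d=1 and e=1 and h=0])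
     (auto intro!: nn_integral_cong simp: simplex_set_def indicator_def)

lemma simplex_mean_swap23:
  assumes F: "measurable3 F"
  shows "simplex_mean F = simplex_mean (\<lambda>x y z. F x z y)"
  unfolding simplex_mean_def
  by (subst nn_integral_plane_swap[OF simplex_mean_integrand_measurable[OF F]])
     (auto intro!: nn_integral_cong simp: simplex_set_def indicator_def algebra_simps)

lemma simplex_mean_add:
  assumes F: "measurable3 F" and G: "measurable3 G"
  shows "simplex_mean (\<lambda>x y z. F x y z + G x y z) = simplex_mean F + simplex_mean G"
  unfolding simplex_mean_def
  by (subst nn_integral_add[symmetric])
     (simp_all add: simplex_mean_integrand_measurable[OF F] simplex_mean_integrand_measurable[OF G] distrib_left distrib_right)

lemma simplex_mean_cmult:
  assumes F: "measurable3 F"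
  shows "simplex_mean (\<lambda>x y z. c * F x y z) = c * simplex_mean F"
proof -
  have "(\<integral>\<^sup>+z. c * (2 * F (1 - fst z - snd z) (fst z) (snd z) * indicator simplex_set z) \<partial>lborel) = c * simplex_mean F"
    unfolding simplex_mean_def
    by (rule nn_integral_cmult) (simp add: simplex_mean_integrand_measurable[OF F])
  then show ?thesis
    by (simp add: simplex_mean_def mult_ac)
qed

lemma measurable3_restrict:
  assumes F: "measurable3 F" and P: "closed {v. P (fst v) (fst (snd v)) (snd (snd v))}"
  shows "measurable3 (\<lambda>x y z. F x y z * (if P x y z then 1 else 0))"
proof -
  have [measurable]: "(\<lambda>v. F (fst v) (fst (snd v)) (snd (snd v))) \<in> borel_measurable borel" by (rule F)
  have [measurable]: "Measurable.pred borel (\<lambda>v. P (fst v) (fst (snd v)) (snd (snd v)))"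
    using borel_closed[OF P] by (simp add: pred_def)
  show ?thesis by measurable
qed

lemma indicator_mult_if:
  fixes X Y :: ennreal
  assumes "(z \<in> A \<and> c) = (w \<in> A)" "X = Y"
  shows "2 * (X * (if c then 1 else 0)) * indicator A z = 2 * Y * indicator A w"
  using assms by (cases "z \<in> A"; cases c) auto

text \<open>The points whose third coordinate is smallest form the triangle on the first two
  vertices and the centroid. The affine map sending the third vertex to the centroid has determinant
  1/3 and carries the simplex onto it.\<close>

lemma simplex_mean_third:
  assumes F: "measurable3 F"
  shows "simplex_mean (\<lambda>x y z. F x y z * (if z \<le> x \<and> z \<le> y then 1 else 0))
    = ennreal (1/3) * simplex_mean (\<lambda>x y z. F (x + z/3) (y + z/3) (z/3))"
proof -
  have m: "measurable3 (\<lambda>x y z. F x y z * (if z \<le> x \<and> z \<le> y then 1 else 0))"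
    by (intro measurable3_restrict F closed_Collect_conj closed_Collect_le continuous_intros)
  show ?thesis
    unfolding simplex_mean_def
    apply (subst nn_integral_plane_affine[OF simplex_mean_integrand_measurable[OF m], where a=1 and b="1/3" and d="1/3" and e=0 and h=0])
      apply simp
     apply simp
    apply (simp only: mult_1 abs_of_nonneg divide_nonneg_nonneg zero_le_one zero_le_numeral fst_conv snd_conv)
    apply (rule arg_cong2[where f="(*)"], rule refl, rule nn_integral_cong)
    subgoal for w
    proof -
      let ?c = "0 + (1/3) * snd w \<le> 1 - (0 + fst w + (1/3) * snd w) - (0 + (1/3) * snd w) \<and> 0 + (1/3) * snd w \<le> 0 + fst w + (1/3) * snd w"
      have eq: "((0 + fst w + (1/3) * snd w, 0 + (1/3) * snd w) \<in> simplex_set \<and> ?c) = (w \<in> simplex_set)"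
        by (auto simp: simplex_set_def)
      show ?thesis
        by (rule indicator_mult_if[OF eq]) (simp add: algebra_simps)
    qed
    done
qed

text \<open>Same idea for the triangle cut off by the median through the first vertex: the third
  vertex moves to the midpoint of the edge between the last two.\<close>

lemma simplex_mean_half:
  assumes F: "measurable3 F"
  shows "simplex_mean (\<lambda>x y z. F x y z * (if z \<le> y then 1 else 0))
    = ennreal (1/2) * simplex_mean (\<lambda>x y z. F x (y + z/2) (z/2))"
proof -
  have m: "measurable3 (\<lambda>x y z. F x y z * (if z \<le> y then 1 else 0))"
    by (intro measurable3_restrict F closed_Collect_conj closed_Collect_le continuous_intros)
  show ?thesis
    unfolding simplex_mean_def
    apply (subst nn_integral_plane_affine[OF simplex_mean_integrand_measurable[OF m], where a=1 and b="1/2" and d="1/2" and e=0 and h=0])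
      apply simp
     apply simp
    apply (simp only: mult_1 abs_of_nonneg divide_nonneg_nonneg zero_le_one zero_le_numeral fst_conv snd_conv)
    apply (rule arg_cong2[where f="(*)"], rule refl, rule nn_integral_cong)
    subgoal for w
    proof -
      let ?c = "0 + (1/2) * snd w \<le> 0 + fst w + (1/2) * snd w"
      have eq: "((0 + fst w + (1/2) * snd w, 0 + (1/2) * snd w) \<in> simplex_set \<and> ?c) = (w \<in> simplex_set)"
        by (auto simp: simplex_set_def)
      show ?thesis
        by (rule indicator_mult_if[OF eq]) (simp add: algebra_simps)
    qed
    done
qed

section \<open>Positive parts of affine functions\<close>

text \<open>Since \<open>ennreal\<close> maps negative reals to 0, this is the mean of the positive part.\<close>

definition affine_mean :: "real \<Rightarrow> real \<Rightarrow> real \<Rightarrow> ennreal" where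
  "affine_mean p q r = simplex_mean (\<lambda>x y z. ennreal (p * x + q * y + r * z))"

lemma measurable3_ennreal:
  assumes "continuous_on UNIV (\<lambda>v. F (fst v) (fst (snd v)) (snd (snd v)))"
  shows "measurable3 (\<lambda>x y z. ennreal (F x y z))"
proof -
  have "(\<lambda>v. F (fst v) (fst (snd v)) (snd (snd v))) \<in> borel_measurable borel"
    using assms by (rule borel_measurable_continuous_onI)
  then show ?thesis by measurable
qed

lemma affine_measurable3: "measurable3 (\<lambda>x y z. ennreal (p * x + q * y + r * z))"
  by (rule measurable3_ennreal) (intro continuous_intros)

lemma affine_mean_swap12: "affine_mean p q r = affine_mean q p r"
  unfolding affine_mean_def
  by (subst simplex_mean_swap12[OF affine_measurable3]) (simp add: algebra_simps)

lemma affine_mean_swap23: "affine_mean p q r = affine_mean p r q"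
  unfolding affine_mean_def
  by (subst simplex_mean_swap23[OF affine_measurable3]) (simp add: algebra_simps)

section \<open>Bounds for the mean of the positive part of an affine function\<close>

lemma nn_integral_pos_part_power:
  fixes v b :: real
  assumes "b > 0" "n > 0"
  shows "(\<integral>\<^sup>+t. ennreal ((max 0 (v - b * t)) ^ n) * indicator {0..} t \<partial>lborel)
    = ennreal ((max 0 v) ^ Suc n / (b * Suc n))"
proof (cases "v \<ge> 0")
  case True
  define T where "T = v / b"
  have T: "T \<ge> 0" "b * T = v" using True assms by (auto simp: T_def)
  have "(\<integral>\<^sup>+t. ennreal ((max 0 (v - b * t)) ^ n) * indicator {0..} t \<partial>lborel)
    = (\<integral>\<^sup>+t. ennreal ((v - b * t) ^ n) * indicator {0..T} t \<partial>lborel)"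
  proof (rule nn_integral_cong)
    fix t :: real
    have "v - b * t \<ge> 0 \<longleftrightarrow> t \<le> T" using assms(1) T(2)
      by (metis diff_ge_0_iff_ge mult_le_cancel_left_pos)
    then show "ennreal ((max 0 (v - b * t)) ^ n) * indicator {0..} t
        = ennreal ((v - b * t) ^ n) * indicator {0..T} t"
      using assms(2) by (auto simp: indicator_def max_def)
  qed
  also have "\<dots> = ennreal (- ((v - b * T) ^ Suc n / (b * Suc n)) - (- ((v - b * 0) ^ Suc n / (b * Suc n))))"
  proof -
    have "((\<lambda>t. - ((v - b * t) ^ Suc n / (b * Suc n))) has_real_derivative (v - b * t) ^ n) (at t within A)" for t A
      using assms by (auto intro!: derivative_eq_intros simp del: power_Suc of_nat_Suc simp: field_simps)
    moreover have "0 \<le> (v - b * t) ^ n" if "0 \<le> t" "t \<le> T" for t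
      using assms(1) T(2) that by (metis diff_ge_0_iff_ge mult_le_cancel_left_pos zero_le_power)
    ultimately show ?thesis
      using T(1) by (intro nn_integral_FTC_Icc) auto
  qed
  finally show ?thesis using True T(2) by simp
next
  case False
  have "max 0 (v - b * t) = 0" if "t \<ge> 0" for t
    using False assms(1) that mult_nonneg_nonneg[of b t] by (intro max_absorb1) linarith
  then have "ennreal ((max 0 (v - b * t)) ^ n) * indicator {0..} t = 0" for t
    using \<open>n > 0\<close> by (cases "t \<ge> 0") auto
  then have "(\<integral>\<^sup>+t. ennreal ((max 0 (v - b * t)) ^ n) * indicator {0..} t \<partial>lborel) = (\<integral>\<^sup>+t. 0 \<partial>(lborel :: real measure))"
    by (simp only:)
  then show ?thesis using False by simp
qed

lemma nn_integral_plane_iterated: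
  fixes f :: "real \<times> real \<Rightarrow> ennreal"
  assumes "f \<in> borel_measurable borel"
  shows "(\<integral>\<^sup>+z. f z \<partial>lborel) = (\<integral>\<^sup>+s. \<integral>\<^sup>+t. f (s, t) \<partial>lborel \<partial>lborel)"
  using lborel.nn_integral_fst[of f lborel] assms by (simp add: lborel_prod)

lemma affine_mean_iterated:
  "affine_mean p q r = (\<integral>\<^sup>+s. \<integral>\<^sup>+t. 2 * ennreal (p * (1 - s - t) + q * s + r * t)
     * indicator simplex_set (s, t) \<partial>lborel \<partial>lborel)"
  unfolding affine_mean_def simplex_mean_def
  by (subst nn_integral_plane_iterated[OF simplex_mean_integrand_measurable[OF affine_measurable3]]) simp

lemma two_times_ennreal: "2 * ennreal x = ennreal (2 * x)"
  using ennreal_mult'[of 2 x] by simp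

text \<open>With the first vertex as origin the affine function is p - (p - q) s - (p - r) t, and
  the triangle is enlarged to the quadrant s, t \<ge> 0. Integrating the positive part in t and then
  in s raises its power from 1 to 2 to 3.\<close>

lemma nn_integral_wedge:
  fixes p q r :: real
  assumes "p > q" "p > r"
  shows "(\<integral>\<^sup>+s. \<integral>\<^sup>+t. 2 * indicator {0..} s * (ennreal (max 0 ((p - (p - q) * s) - (p - r) * t) ^ 1)
     * indicator {0..} t) \<partial>lborel \<partial>lborel) = ennreal (max 0 p ^ 3 / (3 * (p - q) * (p - r)))"
proof -
  have "(\<integral>\<^sup>+s. \<integral>\<^sup>+t. 2 * indicator {0..} s * (ennreal (max 0 ((p - (p - q) * s) - (p - r) * t) ^ 1)
     * indicator {0..} t) \<partial>lborel \<partial>lborel) = (\<integral>\<^sup>+s. ennreal (1 / (p - r)) * (ennreal (max 0 (p - (p - q) * s) ^ 2) * indicator {0..} s) \<partial>lborel)"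
  proof (rule nn_integral_cong)
    fix s :: real
    have A: "(\<integral>\<^sup>+t. 2 * indicator {0..} s * (ennreal (max 0 ((p - (p - q) * s) - (p - r) * t) ^ 1) * indicator {0..} t) \<partial>lborel)
      = indicator {0..} s * (2 * ennreal ((max 0 (p - (p - q) * s)) ^ Suc 1 / ((p - r) * Suc 1)))"
      using assms nn_integral_pos_part_power[of "p - r" 1 "p - (p - q) * s"]
      by (subst nn_integral_cmult) (auto simp: mult_ac)
    have B: "2 * ennreal ((max 0 (p - (p - q) * s)) ^ Suc 1 / ((p - r) * Suc 1))
      = ennreal (1 / (p - r)) * ennreal (max 0 (p - (p - q) * s) ^ 2)"
      unfolding two_times_ennreal using assms by (subst ennreal_mult[symmetric]) (auto simp: power2_eq_square simp del: left_diff_distrib_numeral right_diff_distrib_numeral)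
    show "(\<integral>\<^sup>+t. 2 * indicator {0..} s * (ennreal (max 0 ((p - (p - q) * s) - (p - r) * t) ^ 1) * indicator {0..} t) \<partial>lborel)
      = ennreal (1 / (p - r)) * (ennreal (max 0 (p - (p - q) * s) ^ 2) * indicator {0..} s)"
      unfolding A B by (simp only: mult_ac)
  qed
  also have "\<dots> = ennreal (1 / (p - r)) * ennreal (max 0 p ^ Suc 2 / ((p - q) * Suc 2))"
    using assms nn_integral_pos_part_power[of "p - q" 2 p] by (subst nn_integral_cmult) auto
  also have "\<dots> = ennreal (max 0 p ^ 3 / (3 * (p - q) * (p - r)))"
    using assms by (subst ennreal_mult[symmetric]) (auto simp: eval_nat_numeral field_simps)
  finally show ?thesis .
qed

lemma affine_mean_wedge:
  assumes "p > q" "p > r"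
  shows "affine_mean p q r \<le> ennreal (max 0 p ^ 3 / (3 * (p - q) * (p - r)))"
proof -
  have "affine_mean p q r \<le> (\<integral>\<^sup>+s. \<integral>\<^sup>+t. 2 * indicator {0..} s * (ennreal (max 0 ((p - (p - q) * s) - (p - r) * t) ^ 1)
     * indicator {0..} t) \<partial>lborel \<partial>lborel)"
    unfolding affine_mean_iterated
  proof (intro nn_integral_mono)
    fix s t :: real
    have "p * (1 - s - t) + q * s + r * t \<le> max 0 (p - (p - q) * s - (p - r) * t)"
      by (simp add: algebra_simps)
    then show "2 * ennreal (p * (1 - s - t) + q * s + r * t) * indicator simplex_set (s, t)
      \<le> 2 * indicator {0..} s * (ennreal (max 0 (p - (p - q) * s - (p - r) * t) ^ 1) * indicator {0..} t)"
      by (auto simp: indicator_def simplex_set_def intro!: mult_left_mono ennreal_leI)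
  qed
  also have "\<dots> = ennreal (max 0 p ^ 3 / (3 * (p - q) * (p - r)))"
    by (rule nn_integral_wedge[OF assms])
  finally show ?thesis .
qed

text \<open>If the other two vertex values are nonpositive, the function is nonpositive on the part
  of the wedge beyond the opposite edge, so enlarging the triangle adds nothing. This exact value
  serves the lower bound at the centers.\<close>

lemma affine_mean_corner:
  assumes "p > 0" "q \<le> 0" "r \<le> 0"
  shows "affine_mean p q r = ennreal (p ^ 3 / (3 * (p - q) * (p - r)))"
proof -
  have "affine_mean p q r = (\<integral>\<^sup>+s. \<integral>\<^sup>+t. 2 * indicator {0..} s * (ennreal (max 0 ((p - (p - q) * s) - (p - r) * t) ^ 1)
     * indicator {0..} t) \<partial>lborel \<partial>lborel)"
    unfolding affine_mean_iterated
  proof (intro nn_integral_cong)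
    fix s t :: real
    let ?v = "p - (p - q) * s - (p - r) * t"
    have eq: "p * (1 - s - t) + q * s + r * t = ?v"
      by (simp add: algebra_simps)
    have "?v \<le> 0" if "0 \<le> s" "0 \<le> t" "1 < s + t"
    proof -
      have "p * (1 - s - t) \<le> 0" "q * s \<le> 0" "r * t \<le> 0"
        using assms that by (auto simp: mult_le_0_iff)
      then show ?thesis using eq by linarith
    qed
    moreover have "ennreal (max 0 ?v ^ 1) = ennreal ?v"
      by (simp add: max_def ennreal_neg)
    ultimately show "2 * ennreal (p * (1 - s - t) + q * s + r * t) * indicator simplex_set (s, t)
      = 2 * indicator {0..} s * (ennreal (max 0 ?v ^ 1) * indicator {0..} t)"
      unfolding eq by (auto simp: indicator_def simplex_set_def ennreal_neg)
  qed
  also have "\<dots> = ennreal (max 0 p ^ 3 / (3 * (p - q) * (p - r)))"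
    by (rule nn_integral_wedge) (use assms in auto)
  finally show ?thesis using assms by (simp add: max_def)
qed

text \<open>The triangle is enlarged to a half strip based on the edge with end values p and q and
  running towards the third vertex. Integrating across the strip leaves v^2 / (q - r), where v is
  the value on the edge. Only q > r is required; p may lie on either side of both.\<close>

lemma affine_mean_strip:
  assumes "q > r"
  shows "affine_mean p q r \<le> ennreal ((p\<^sup>2 + p * q + q\<^sup>2) / (3 * (q - r)))"
proof -
  have "affine_mean p q r = affine_mean q p r"
    by (rule affine_mean_swap12)
  also have "\<dots> \<le> (\<integral>\<^sup>+s. \<integral>\<^sup>+t. 2 * indicator {0..1} s * (ennreal (max 0 ((q + (p - q) * s) - (q - r) * t) ^ 1)
     * indicator {0..} t) \<partial>lborel \<partial>lborel)"
    unfolding affine_mean_iterated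
  proof (intro nn_integral_mono)
    fix s t :: real
    have "q * (1 - s - t) + p * s + r * t \<le> max 0 (q + (p - q) * s - (q - r) * t)"
      by (simp add: algebra_simps)
    then show "2 * ennreal (q * (1 - s - t) + p * s + r * t) * indicator simplex_set (s, t)
      \<le> 2 * indicator {0..1} s * (ennreal (max 0 (q + (p - q) * s - (q - r) * t) ^ 1) * indicator {0..} t)"
      by (auto simp: indicator_def simplex_set_def intro!: mult_left_mono ennreal_leI)
  qed
  also have "\<dots> \<le> (\<integral>\<^sup>+s. ennreal ((q + (p - q) * s)\<^sup>2 / (q - r)) * indicator {0..1} s \<partial>lborel)"
  proof (rule nn_integral_mono)
    fix s :: real
    have "(\<integral>\<^sup>+t. 2 * indicator {0..1} s * (ennreal (max 0 ((q + (p - q) * s) - (q - r) * t) ^ 1) * indicator {0..} t) \<partial>lborel)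
      = indicator {0..1} s * (2 * ennreal ((max 0 (q + (p - q) * s)) ^ Suc 1 / ((q - r) * Suc 1)))"
      using assms nn_integral_pos_part_power[of "q - r" 1 "q + (p - q) * s"]
      by (subst nn_integral_cmult) (auto simp: mult_ac)
    moreover have "2 * ennreal ((max 0 (q + (p - q) * s)) ^ Suc 1 / ((q - r) * Suc 1))
      \<le> ennreal ((q + (p - q) * s)\<^sup>2 / (q - r))"
    proof -
      have "(max 0 (q + (p - q) * s))\<^sup>2 / (q - r) \<le> (q + (p - q) * s)\<^sup>2 / (q - r)"
        using assms by (intro divide_right_mono) (auto simp: max_def)
      then show ?thesis
        unfolding two_times_ennreal
        by (intro ennreal_leI) (simp add: power2_eq_square del: left_diff_distrib_numeral right_diff_distrib_numeral)
    qed
    ultimately show "(\<integral>\<^sup>+t. 2 * indicator {0..1} s * (ennreal (max 0 ((q + (p - q) * s) - (q - r) * t) ^ 1) * indicator {0..} t) \<partial>lborel)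
      \<le> ennreal ((q + (p - q) * s)\<^sup>2 / (q - r)) * indicator {0..1} s"
      by (simp only: mult.commute[of "indicator {0..1} s"] mult_right_mono zero_le)
  qed
  also have "\<dots> = ennreal ((p\<^sup>2 + p * q + q\<^sup>2) / (3 * (q - r)))"
  proof -
    let ?F = "\<lambda>s. q\<^sup>2 * s + q * (p - q) * s\<^sup>2 + (p - q)\<^sup>2 * s ^ 3 / 3"
    have "(?F has_real_derivative (q + (p - q) * s)\<^sup>2) (at s within A)" for s A
      by (auto intro!: derivative_eq_intros simp: power2_eq_square field_simps)
    then have "(\<integral>\<^sup>+s. ennreal ((q + (p - q) * s)\<^sup>2 / (q - r)) * indicator {0..1} s \<partial>lborel)
      = ennreal (?F 1 / (q - r) - ?F 0 / (q - r))"
      using assms by (intro nn_integral_FTC_Icc DERIV_cdivide) auto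
    moreover have F1: "?F 1 = (p\<^sup>2 + p * q + q\<^sup>2) / 3"
      by (simp add: field_simps power2_eq_square)
    have "?F 1 / (q - r) - ?F 0 / (q - r) = (p\<^sup>2 + p * q + q\<^sup>2) / (3 * (q - r))"
      unfolding F1 by (simp del: right_diff_distrib_numeral)
    ultimately show ?thesis by (simp only:)
  qed
  finally show ?thesis .
qed

text \<open>The positive part is convex, so it lies below the interpolation of its vertex values,
  and each barycentric coordinate has mean 1/3.\<close>

lemma affine_mean_vertices: "affine_mean p q r \<le> ennreal ((max 0 p + max 0 q + max 0 r) / 3)"
proof -
  have one: "affine_mean (max 0 v) 0 0 \<le> ennreal (max 0 v / 3)" for v
  proof (cases "v > 0")
    case True
    then show ?thesis using affine_mean_wedge[of 0 "max 0 v" 0]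
      by (simp add: max_def eval_nat_numeral)
  next
    case False
    then show ?thesis by (simp add: max_def affine_mean_def simplex_mean_def)
  qed
  have "affine_mean p q r \<le> simplex_mean (\<lambda>x y z. (ennreal (max 0 p * x + 0 * y + 0 * z)
      + ennreal (0 * x + max 0 q * y + 0 * z)) + ennreal (0 * x + 0 * y + max 0 r * z))"
    unfolding affine_mean_def
  proof (rule simplex_mean_mono)
    fix x y z :: real
    assume "0 \<le> x" "0 \<le> y" "0 \<le> z"
    then have "p * x + q * y + r * z \<le> max 0 p * x + max 0 q * y + max 0 r * z"
      by (intro add_mono mult_right_mono) auto
    with \<open>0 \<le> x\<close> \<open>0 \<le> y\<close> \<open>0 \<le> z\<close> show "ennreal (p * x + q * y + r * z) \<le> (ennreal (max 0 p * x + 0 * y + 0 * z)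
      + ennreal (0 * x + max 0 q * y + 0 * z)) + ennreal (0 * x + 0 * y + max 0 r * z)"
      by (simp add: ennreal_plus[symmetric] ennreal_leI del: ennreal_plus)
  qed
  also have "\<dots> = affine_mean (max 0 p) 0 0 + affine_mean 0 (max 0 q) 0 + affine_mean 0 0 (max 0 r)"
    unfolding affine_mean_def
    by (simp only: simplex_mean_add[OF borel_measurable_add[OF affine_measurable3 affine_measurable3] affine_measurable3]
      simplex_mean_add[OF affine_measurable3 affine_measurable3])
  also have "\<dots> = affine_mean (max 0 p) 0 0 + affine_mean (max 0 q) 0 0 + affine_mean (max 0 r) 0 0"
    by (metis affine_mean_swap12 affine_mean_swap23)
  also have "\<dots> \<le> ennreal (max 0 p / 3) + ennreal (max 0 q / 3) + ennreal (max 0 r / 3)"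
    by (intro add_mono one)
  finally show ?thesis
    by (simp add: ennreal_plus[symmetric] add_divide_distrib del: ennreal_plus)
qed

text \<open>Equivalent to the second moments E x^2 = 1/6 and E x y = 1/12 of the barycentric
  coordinates.\<close>

lemma affine_square_mean:
  "simplex_mean (\<lambda>x y z. ennreal ((p * x + q * y + r * z)\<^sup>2))
    = ennreal ((p\<^sup>2 + q\<^sup>2 + r\<^sup>2 + (p + q + r)\<^sup>2) / 12)"
proof -
  have m: "measurable3 (\<lambda>x y z. ennreal ((p * x + q * y + r * z)\<^sup>2))"
    by (rule measurable3_ennreal) (intro continuous_intros)
  have "simplex_mean (\<lambda>x y z. ennreal ((p * x + q * y + r * z)\<^sup>2))
    = (\<integral>\<^sup>+s. \<integral>\<^sup>+t. 2 * indicator {0..1} s * (ennreal ((p * (1 - s - t) + q * s + r * t)\<^sup>2) * indicator {0..1 - s} t) \<partial>lborel \<partial>lborel)"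
    unfolding simplex_mean_def
    by (subst nn_integral_plane_iterated[OF simplex_mean_integrand_measurable[OF m]])
       (auto intro!: nn_integral_cong simp: indicator_def simplex_set_def)
  also have "\<dots> = (\<integral>\<^sup>+s. ennreal (2 * ((p + (q - p) * s)\<^sup>2 * (1 - s) + (p + (q - p) * s) * (r - p) * (1 - s)\<^sup>2
      + (r - p)\<^sup>2 * (1 - s) ^ 3 / 3)) * indicator {0..1} s \<partial>lborel)"
  proof (rule nn_integral_cong)
    fix s :: real
    let ?I = "(p + (q - p) * s)\<^sup>2 * (1 - s) + (p + (q - p) * s) * (r - p) * (1 - s)\<^sup>2 + (r - p)\<^sup>2 * (1 - s) ^ 3 / 3"
    have "(\<integral>\<^sup>+t. ennreal ((p * (1 - s - t) + q * s + r * t)\<^sup>2) * indicator {0..1 - s} t \<partial>lborel) = ennreal (?I - 0)" if "s \<le> 1"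
    proof -
      let ?F = "\<lambda>t. (p + (q - p) * s)\<^sup>2 * t + (p + (q - p) * s) * (r - p) * t\<^sup>2 + (r - p)\<^sup>2 * t ^ 3 / 3"
      have "(?F has_real_derivative (p * (1 - s - t) + q * s + r * t)\<^sup>2) (at t within A)" for t A
        by (auto intro!: derivative_eq_intros simp: power2_eq_square field_simps)
      then have "(\<integral>\<^sup>+t. ennreal ((p * (1 - s - t) + q * s + r * t)\<^sup>2) * indicator {0..1 - s} t \<partial>lborel) = ennreal (?F (1 - s) - ?F 0)"
        using that by (intro nn_integral_FTC_Icc) auto
      then show ?thesis by simp
    qed
    then show "(\<integral>\<^sup>+t. 2 * indicator {0..1} s * (ennreal ((p * (1 - s - t) + q * s + r * t)\<^sup>2) * indicator {0..1 - s} t) \<partial>lborel)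
      = ennreal (2 * ?I) * indicator {0..1} s"
      by (subst nn_integral_cmult) (auto simp: indicator_def two_times_ennreal simp del: distrib_left_numeral)
  qed
  also have "\<dots> = ennreal ((p\<^sup>2 + q\<^sup>2 + r\<^sup>2 + (p + q + r)\<^sup>2) / 12)"
  proof -
    let ?f = "\<lambda>s. 2 * ((p + (q - p) * s)\<^sup>2 * (1 - s) + (p + (q - p) * s) * (r - p) * (1 - s)\<^sup>2
      + (r - p)\<^sup>2 * (1 - s) ^ 3 / 3)"
    let ?F = "\<lambda>s. 2 * (p\<^sup>2 * (s - s\<^sup>2 / 2) + 2 * p * (q - p) * (s\<^sup>2 / 2 - s ^ 3 / 3)
      + (q - p)\<^sup>2 * (s ^ 3 / 3 - s ^ 4 / 4) + p * (r - p) * (s - s\<^sup>2 + s ^ 3 / 3)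
      + (q - p) * (r - p) * (s\<^sup>2 / 2 - 2 * s ^ 3 / 3 + s ^ 4 / 4)
      + (r - p)\<^sup>2 / 3 * (s - 3 * s\<^sup>2 / 2 + s ^ 3 - s ^ 4 / 4))"
    have "(?F has_real_derivative ?f s) (at s within A)" for s A
      by (auto intro!: derivative_eq_intros simp: power2_eq_square power3_eq_cube field_simps)
    moreover have "0 \<le> ?f s" if s: "0 \<le> s" "s \<le> 1" for s
    proof -
      have *: "0 \<le> a\<^sup>2 + a * b + b\<^sup>2 / 3" for a b :: real
      proof -
        have "a\<^sup>2 + a * b + b\<^sup>2 / 3 = (a + b / 2)\<^sup>2 + b\<^sup>2 / 12"
          by (simp add: power2_eq_square algebra_simps)
        then show ?thesis by simp
      qed
      let ?a = "p + (q - p) * s" and ?b = "(r - p) * (1 - s)"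
      have "0 \<le> 2 * ((1 - s) * (?a\<^sup>2 + ?a * ?b + ?b\<^sup>2 / 3))"
        using s *[of ?a ?b] by simp
      also have "\<dots> = ?f s"
        by (simp only: power2_eq_square power3_eq_cube distrib_left mult_ac times_divide_eq_right)
      finally show ?thesis .
    qed
    ultimately have "(\<integral>\<^sup>+s. ennreal (?f s) * indicator {0..1} s \<partial>lborel) = ennreal (?F 1 - ?F 0)"
      by (intro nn_integral_FTC_Icc) auto
    also have "?F 1 - ?F 0 = (p\<^sup>2 + q\<^sup>2 + r\<^sup>2 + (p + q + r)\<^sup>2) / 12"
      by (simp add: power2_eq_square field_simps)
    finally show ?thesis .
  qed
  finally show ?thesis by simp
qed

text \<open>The parabola (v + k)^2 / (4 k) is nonnegative and touches the line v at v = k, so it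
  dominates the positive part, and its mean is explicit. The parameter k is adapted to the region
  where the bound is applied.\<close>

lemma affine_mean_quadratic:
  assumes "k > 0"
  shows "affine_mean p q r \<le> ennreal (((p + k)\<^sup>2 + (q + k)\<^sup>2 + (r + k)\<^sup>2 + (p + q + r + 3 * k)\<^sup>2) / (48 * k))"
proof -
  have m: "measurable3 (\<lambda>x y z. ennreal (((p + k) * x + (q + k) * y + (r + k) * z)\<^sup>2))"
    by (rule measurable3_ennreal) (intro continuous_intros)
  have "affine_mean p q r \<le> simplex_mean (\<lambda>x y z. ennreal (1 / (4 * k)) * ennreal (((p + k) * x + (q + k) * y + (r + k) * z)\<^sup>2))"
    unfolding affine_mean_def
  proof (rule simplex_mean_mono)
    fix x y z :: real
    assume "x + y + z = 1"
    then have x: "x = 1 - y - z" by simp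
    let ?u = "p * x + q * y + r * z"
    have eq: "(p + k) * x + (q + k) * y + (r + k) * z = ?u + k"
      unfolding x by (simp add: algebra_simps)
    have "0 \<le> (?u - k)\<^sup>2" by simp
    then have "4 * k * ?u \<le> (?u + k)\<^sup>2" by (simp add: power2_eq_square algebra_simps)
    then have "?u \<le> 1 / (4 * k) * (?u + k)\<^sup>2" using assms by (simp add: field_simps)
    then show "ennreal ?u \<le> ennreal (1 / (4 * k)) * ennreal (((p + k) * x + (q + k) * y + (r + k) * z)\<^sup>2)"
      unfolding eq using assms by (subst ennreal_mult[symmetric]) (auto intro: ennreal_leI)
  qed
  also have "\<dots> = ennreal (1 / (4 * k)) * ennreal (((p + k)\<^sup>2 + (q + k)\<^sup>2 + (r + k)\<^sup>2 + ((p + k) + (q + k) + (r + k))\<^sup>2) / 12)"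
    by (simp only: simplex_mean_cmult[OF m] affine_square_mean)
  also have "\<dots> = ennreal (((p + k)\<^sup>2 + (q + k)\<^sup>2 + (r + k)\<^sup>2 + (p + q + r + 3 * k)\<^sup>2) / (48 * k))"
  proof -
    have "1 / (4 * k) * (X / 12) = X / (48 * k)" for X by simp
    moreover have "(p + k) + (q + k) + (r + k) = p + q + r + 3 * k" by simp
    ultimately show ?thesis
      using assms by (subst ennreal_mult[symmetric]) (simp_all only:, auto)
  qed
  finally show ?thesis .
qed

section \<open>Affine functions plus a multiple of the smallest coordinate\<close>

text \<open>The function \<open>432 (g(x) - |x - a|\<^sup>2)\<close> in barycentric coordinates: \<open>a\<close>, \<open>b\<close>, \<open>c\<close> are its values at the
  vertices, and its value at the centroid is \<open>(a + b + c) / 3 + 30\<close>.\<close>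

definition cone_mean :: "real \<Rightarrow> real \<Rightarrow> real \<Rightarrow> ennreal" where
  "cone_mean a b c = simplex_mean (\<lambda>x y z. ennreal (a * x + b * y + c * z + 90 * min x (min y z)))"

lemma cone_measurable3:
  "measurable3 (\<lambda>x y z. ennreal (a * x + b * y + c * z + 90 * min x (min y z)))"
  by (rule measurable3_ennreal) (intro continuous_intros)

lemma cone_mean_swap12: "cone_mean a b c = cone_mean b a c"
  unfolding cone_mean_def
  by (subst simplex_mean_swap12[OF cone_measurable3]) (simp add: ac_simps min.left_commute)

lemma cone_mean_swap23: "cone_mean a b c = cone_mean a c b"
  unfolding cone_mean_def
  by (subst simplex_mean_swap23[OF cone_measurable3]) (simp add: ac_simps)

text \<open>Joining the centroid to the vertices gives three triangles on which the function is
  affine, with value m at the centroid. The closed pieces cover the triangle, which is enough for an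
  upper bound; their overlaps need no treatment.\<close>

lemma cone_mean_trisect:
  assumes m: "m = (a + b + c) / 3 + 30"
  shows "cone_mean a b c \<le> ennreal (1/3) * (affine_mean a b m + affine_mean a c m + affine_mean b c m)"
proof -
  let ?F = "\<lambda>a b c x y z. ennreal (a * x + b * y + c * z + 90 * min x (min y z))"
  let ?G = "\<lambda>a b c x y z. ?F a b c x y z * (if z \<le> x \<and> z \<le> y then 1 else 0)"
  have mG: "measurable3 (?G a b c)" for a b c
    by (intro measurable3_restrict cone_measurable3 closed_Collect_conj closed_Collect_le continuous_intros)
  have G: "simplex_mean (?G a b c) = ennreal (1/3) * affine_mean a b ((a + b + c) / 3 + 30)" for a b c
    unfolding simplex_mean_third[OF cone_measurable3] affine_mean_def
  proof (rule arg_cong2[where f="(*)"], rule refl, rule simplex_mean_cong)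
    fix x y z :: real
    assume "0 \<le> x" "0 \<le> y"
    then have min: "min (x + z/3) (min (y + z/3) (z/3)) = z/3" by auto
    show "ennreal (a * (x + z/3) + b * (y + z/3) + c * (z/3) + 90 * min (x + z/3) (min (y + z/3) (z/3)))
      = ennreal (a * x + b * y + ((a + b + c) / 3 + 30) * z)"
      unfolding min by (simp add: algebra_simps add_divide_distrib)
  qed
  have "cone_mean a b c \<le> simplex_mean (\<lambda>x y z. ?G a b c x y z + ?G a c b x z y + ?G c b a z y x)"
    unfolding cone_mean_def
  proof (rule simplex_mean_mono)
    fix x y z :: real
    have "(z \<le> x \<and> z \<le> y) \<or> (y \<le> x \<and> y \<le> z) \<or> (x \<le> z \<and> x \<le> y)" by linarith
    then show "?F a b c x y z \<le> ?G a b c x y z + ?G a c b x z y + ?G c b a z y x"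
      by (elim disjE) (simp_all add: ac_simps min.left_commute min.commute add_increasing add_increasing2)
  qed
  also have "\<dots> = simplex_mean (?G a b c) + simplex_mean (?G a c b) + simplex_mean (?G c b a)"
  proof -
    have m2: "measurable3 (\<lambda>x y z. ?G a c b x z y)" and m3: "measurable3 (\<lambda>x y z. ?G c b a z y x)"
      by (intro measurable3_restrict measurable3_ennreal closed_Collect_conj closed_Collect_le continuous_intros)+
    have "simplex_mean (\<lambda>x y z. ?G a c b x z y) = simplex_mean (?G a c b)"
      by (rule simplex_mean_swap23[OF mG, symmetric])
    moreover have "simplex_mean (\<lambda>x y z. ?G c b a z y x) = simplex_mean (?G c b a)"
    proof -
      have "simplex_mean (?G c b a) = simplex_mean (\<lambda>x y z. ?G c b a y x z)"
        by (rule simplex_mean_swap12[OF mG])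
      also have "\<dots> = simplex_mean (\<lambda>x y z. ?G c b a z x y)"
        by (rule simplex_mean_swap23) (intro measurable3_restrict measurable3_ennreal closed_Collect_conj closed_Collect_le continuous_intros)
      also have "\<dots> = simplex_mean (\<lambda>x y z. ?G c b a z y x)"
        by (rule simplex_mean_swap12) (intro measurable3_restrict measurable3_ennreal closed_Collect_conj closed_Collect_le continuous_intros)
      finally show ?thesis ..
    qed
    ultimately show ?thesis
      by (simp only: simplex_mean_add[OF borel_measurable_add[OF mG m2] m3] simplex_mean_add[OF mG m2])
  qed
  also have "\<dots> = ennreal (1/3) * (affine_mean a b m + affine_mean a c m + affine_mean b c m)"
    unfolding G m by (simp add: distrib_left add.commute add.left_commute affine_mean_swap12[of c b])
  finally show ?thesis .
qed

text \<open>Replacing the smallest coordinate by the smaller of the last two only increases the function and makes it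
  affine on each half of the triangle.\<close>

lemma cone_mean_bisect:
  assumes m: "m = (b + c) / 2 + 45"
  shows "cone_mean a b c \<le> ennreal (1/2) * (affine_mean a b m + affine_mean a c m)"
proof -
  let ?F = "\<lambda>b c x y z. ennreal (a * x + b * y + c * z + 90 * z)"
  let ?G = "\<lambda>b c x y z. ?F b c x y z * (if z \<le> y then 1 else 0)"
  have mF: "measurable3 (?F b c)" for b c
    by (rule measurable3_ennreal) (intro continuous_intros)
  have mG: "measurable3 (?G b c)" for b c
    by (intro measurable3_restrict mF closed_Collect_le continuous_intros)
  \<comment> \<open>The new vertex of this half is the midpoint of the last edge, where z = 1/2;
    hence the summand 45 = 90 / 2.\<close>
  have G: "simplex_mean (?G b c) = ennreal (1/2) * affine_mean a b ((b + c) / 2 + 45)" for b c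
    unfolding simplex_mean_half[OF mF] affine_mean_def
    by (intro arg_cong2[where f="(*)"] refl simplex_mean_cong) (simp add: algebra_simps add_divide_distrib)
  have "cone_mean a b c \<le> simplex_mean (\<lambda>x y z. ?G b c x y z + ?G c b x z y)"
    unfolding cone_mean_def
  proof (rule simplex_mean_mono)
    fix x y z :: real
    show "ennreal (a * x + b * y + c * z + 90 * min x (min y z)) \<le> ?G b c x y z + ?G c b x z y"
    proof (cases "z \<le> y")
      case True
      then have "a * x + b * y + c * z + 90 * min x (min y z) \<le> a * x + b * y + c * z + 90 * z" by simp
      then have "ennreal (a * x + b * y + c * z + 90 * min x (min y z)) \<le> ?G b c x y z"
        using True by (simp add: ennreal_leI)
      then show ?thesis by (rule add_increasing2[OF zero_le])
    next
      case False
      then have "a * x + b * y + c * z + 90 * min x (min y z) \<le> a * x + c * z + b * y + 90 * y" by simp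
      with False show ?thesis by (auto intro!: ennreal_leI)
    qed
  qed
  also have "\<dots> = simplex_mean (?G b c) + simplex_mean (?G c b)"
  proof -
    have m2: "measurable3 (\<lambda>x y z. ?G c b x z y)"
      by (intro measurable3_restrict measurable3_ennreal closed_Collect_le continuous_intros)
    show ?thesis
      unfolding simplex_mean_add[OF mG m2] by (subst simplex_mean_swap23[OF m2]) (rule refl)
  qed
  also have "\<dots> = ennreal (1/2) * (affine_mean a b m + affine_mean a c m)"
    unfolding G m by (simp add: distrib_left add.commute)
  finally show ?thesis .
qed

lemma cone_mean_trisect_le:
  assumes "m = (a + b + c) / 3 + 30"
    and "affine_mean a b m \<le> ennreal A" "affine_mean a c m \<le> ennreal B" "affine_mean b c m \<le> ennreal C"
    and "0 \<le> A" "0 \<le> B" "0 \<le> C"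
  shows "cone_mean a b c \<le> ennreal ((A + B + C) / 3)"
proof -
  have "cone_mean a b c \<le> ennreal (1/3) * (ennreal A + ennreal B + ennreal C)"
    by (rule order_trans[OF cone_mean_trisect[OF assms(1)]]) (intro mult_left_mono add_mono assms zero_le)
  also have "\<dots> = ennreal ((A + B + C) / 3)"
    using assms by (simp add: ennreal_plus[symmetric] ennreal_mult[symmetric] del: ennreal_plus)
  finally show ?thesis .
qed

text \<open>In the next lemmas \<open>\<alpha> = 12 \<surd>3 (a - centroid)\<close> is described by its components \<open>w\<^sub>k\<close> in the directions of the
  vertices: \<open>w\<^sub>1 = p\<close> and \<open>w\<^sub>2 - w\<^sub>3 = d\<close>, or \<open>w\<^sub>3 = - \<rho>\<close> and \<open>w\<^sub>1 - w\<^sub>2 = u\<close>. Then \<open>R = |\<alpha>|\<^sup>2\<close>, and the function has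
  the values \<open>24 w\<^sub>k - 5 - R\<close> at the vertices and \<open>25 - R\<close> at the centroid. The polynomial below is the slack of
  the bound used when \<open>\<alpha>\<close> is close to the bisector of two vertex directions, after clearing denominators. It is
  concave in \<open>u\<close>, which leaves \<open>u = 0\<close> and \<open>u = 11/4\<close>; the sign of the two resulting sextics is read off from
  their Bernstein coefficients.\<close>

definition ridge_polynomial :: "real \<Rightarrow> real \<Rightarrow> real" where
  "ridge_polynomial \<rho> u =
    (let R = \<rho>\<^sup>2 + u\<^sup>2 / 3; y1 = 12 * \<rho> + 12 * u - 5 - R; y2 = 12 * \<rho> - 12 * u - 5 - R; z = 25 - R
     in (599/20 - ((z + 20)\<^sup>2 + (y1 + 20)\<^sup>2 + (y2 + 20)\<^sup>2 + (z + y1 + y2 + 60)\<^sup>2) / 960)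
          * (36 * (3 * \<rho> + u)) * (18 * (5 + 4 * \<rho>))
        - (z\<^sup>2 + z * y1 + y1\<^sup>2) * (18 * (5 + 4 * \<rho>)) - (y2\<^sup>2 + y2 * z + z\<^sup>2) * (36 * (3 * \<rho> + u)))"

lemma ridge_sextic_left:
  fixes \<rho> :: real
  assumes "7/5 \<le> \<rho>" "\<rho> \<le> 41/4"
  shows "0 \<le> - 972 * \<rho> ^ 6 + 8937 * \<rho> ^ 5 + 60156 * \<rho> ^ 4 - 495450 * \<rho> ^ 3 + 835812 * \<rho>\<^sup>2 + 984015 * \<rho> - 472500"
proof -
  define s t where "s = \<rho> - 7/5" and "t = 177/20 - s"
  have st: "s \<ge> 0" "t \<ge> 0" and \<rho>: "\<rho> = s + 7/5"
    using assms by (auto simp: s_def t_def)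
  \<comment> \<open>Here s + t = 177/20 is the length of the interval, and the constant is a
    positive multiple of (s + t)^6. It makes the polynomial homogeneous in s and t; the coefficients
    are the Bernstein coefficients up to positive factors.\<close>
  have "30749609024289/4 * (- 972 * \<rho> ^ 6 + 8937 * \<rho> ^ 5 + 60156 * \<rho> ^ 4 - 495450 * \<rho> ^ 3 + 835812 * \<rho>\<^sup>2 + 984015 * \<rho> - 472500)
    = 23290234103808 * t ^ 6 + 311305501877760 * s * t ^ 5 + 770544622137600 * s ^ 2 * t ^ 4
      + 27302953824000 * s ^ 3 * t ^ 3 + 7462065717517500 * s ^ 4 * t ^ 2 + 17178373377928125 * s ^ 5 * t
      + 1788926266968750 * s ^ 6"
    unfolding \<rho> t_def by algebra
  moreover have "\<dots> \<ge> 0"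
    using st by (intro add_nonneg_nonneg mult_nonneg_nonneg zero_le_power) simp_all
  ultimately show ?thesis by simp
qed

text \<open>The interval is cut at 6, and on each piece all coefficients of the homogenized
  polynomial are positive. The factors are (23/5)^6 and (17/4)^6 up to positive constants.\<close>

lemma ridge_sextic_right:
  fixes \<rho> :: real
  assumes "7/5 \<le> \<rho>" "\<rho> \<le> 41/4"
  shows "0 \<le> - 995328 * \<rho> ^ 6 + 8239104 * \<rho> ^ 5 + 66998016 * \<rho> ^ 4 - 507771648 * \<rho> ^ 3 + 857710512 * \<rho>\<^sup>2 + 472995192 * \<rho> - 952953975"
proof (cases "\<rho> \<le> 6")
  case True
  define s t where "s = \<rho> - 7/5" and "t = 23/5 - s"
  have st: "s \<ge> 0" "t \<ge> 0" and \<rho>: "\<rho> = s + 7/5"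
    using assms True by (auto simp: s_def t_def)
  have "148035889 * (- 995328 * \<rho> ^ 6 + 8239104 * \<rho> ^ 5 + 66998016 * \<rho> ^ 4 - 507771648 * \<rho> ^ 3 + 857710512 * \<rho>\<^sup>2 + 472995192 * \<rho> - 952953975)
    = 4550368658793 * t ^ 6 + 81236895086910 * s * t ^ 5 + 232688525603775 * s ^ 2 * t ^ 4
      + 170275740418500 * s ^ 3 * t ^ 3 + 526293943044375 * s ^ 4 * t ^ 2 + 1089717559518750 * s ^ 5 * t
      + 430353092390625 * s ^ 6"
    unfolding \<rho> t_def by algebra
  moreover have "\<dots> \<ge> 0"
    using st by (intro add_nonneg_nonneg mult_nonneg_nonneg zero_le_power) simp_all
  ultimately show ?thesis by simp
next
  case False
  define s t where "s = \<rho> - 6" and "t = 17/4 - s"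
  have st: "s \<ge> 0" "t \<ge> 0" and \<rho>: "\<rho> = s + 6"
    using assms False by (auto simp: s_def t_def)
  have "24137569/4096 * (- 995328 * \<rho> ^ 6 + 8239104 * \<rho> ^ 5 + 66998016 * \<rho> ^ 4 - 507771648 * \<rho> ^ 3 + 857710512 * \<rho>\<^sup>2 + 472995192 * \<rho> - 952953975)
    = 27542597913 * t ^ 6 + 253501907172 * s * t ^ 5 + 938120610936 * s ^ 2 * t ^ 4
      + 1750386044256 * s ^ 3 * t ^ 3 + 1671460120608 * s ^ 4 * t ^ 2 + 703731137088 * s ^ 5 * t
      + 64630329792 * s ^ 6"
    unfolding \<rho> t_def by algebra
  moreover have "\<dots> \<ge> 0"
    using st by (intro add_nonneg_nonneg mult_nonneg_nonneg zero_le_power) simp_all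
  ultimately show ?thesis by simp
qed

lemma ridge_polynomial_nonneg:
  fixes \<rho> u :: real
  assumes "7/5 \<le> \<rho>" "\<rho> \<le> 41/4" "0 \<le> u" "u \<le> 11/4"
  shows "0 \<le> ridge_polynomial \<rho> u"
proof -
  \<comment> \<open>- \<open>c2\<close>, ..., - \<open>c5\<close> are the coefficients of u^2, ...,
    u^5 in 10 * \<open>ridge_polynomial\<close>; their signs give the concavity in u.\<close>
  define c2 where "c2 = 648 * \<rho> ^ 4 - 774 * \<rho> ^ 3 - 6192 * \<rho>\<^sup>2 + 117630 * \<rho> + 46800"
  define c3 where "c3 = 216 * \<rho> ^ 3 - 738 * \<rho>\<^sup>2 + 216 * \<rho> + 36810"
  define c4 where "c4 = 108 * \<rho>\<^sup>2 + 735 * \<rho> + 4620"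
  define c5 where "c5 = 36 * \<rho> + 165"
  have "c2 = \<rho> ^ 3 * (648 * \<rho> - 774) + \<rho> * (117630 - 6192 * \<rho>) + 46800"
    unfolding c2_def by algebra
  moreover have "0 \<le> \<rho> ^ 3 * (648 * \<rho> - 774)" "0 \<le> \<rho> * (117630 - 6192 * \<rho>)"
    using assms by (intro mult_nonneg_nonneg; simp)+
  ultimately have "0 \<le> c2" by linarith
  have "c3 = 216 * \<rho> * (\<rho> - 41/24)\<^sup>2 + (36810 - 3315/8 * \<rho>)"
    unfolding c3_def by algebra
  moreover have "0 \<le> 216 * \<rho> * (\<rho> - 41/24)\<^sup>2" using assms by simp
  ultimately have "0 \<le> c3" using assms by linarith
  have "0 \<le> c4" "0 \<le> c5" using assms by (auto simp: c4_def c5_def)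
  let ?U = "11/4 :: real"
  \<comment> \<open>The first two summands are the chord between u = 0 and u = 11/4, where the
    sextics are the end values up to the factors 10 and 10240. The last one is the excess over the
    chord, from u U^(k-1) - u^k = u (U - u) (u^(k-2) + ... + U^(k-2)).\<close>
  have "10 * (?U * ridge_polynomial \<rho> u)
    = (?U - u) * (- 972 * \<rho> ^ 6 + 8937 * \<rho> ^ 5 + 60156 * \<rho> ^ 4 - 495450 * \<rho> ^ 3 + 835812 * \<rho>\<^sup>2 + 984015 * \<rho> - 472500)
      + u / 1024 * (- 995328 * \<rho> ^ 6 + 8239104 * \<rho> ^ 5 + 66998016 * \<rho> ^ 4 - 507771648 * \<rho> ^ 3 + 857710512 * \<rho>\<^sup>2 + 472995192 * \<rho> - 952953975)
      + u * ?U * (?U - u) * (c2 + c3 * (u + ?U) + c4 * (u\<^sup>2 + u * ?U + ?U\<^sup>2) + c5 * (u ^ 3 + u\<^sup>2 * ?U + u * ?U\<^sup>2 + ?U ^ 3))"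
    unfolding ridge_polynomial_def Let_def c2_def c3_def c4_def c5_def by algebra
  moreover have "\<dots> \<ge> 0"
    using assms ridge_sextic_left[OF assms(1,2)] ridge_sextic_right[OF assms(1,2)]
      \<open>0 \<le> c2\<close> \<open>0 \<le> c3\<close> \<open>0 \<le> c4\<close> \<open>0 \<le> c5\<close>
    by (intro add_nonneg_nonneg mult_nonneg_nonneg divide_nonneg_pos zero_le_power) simp_all
  ultimately show ?thesis by simp
qed

text \<open>The vertex estimate on the line d = 3 p - 11/2, that is u = 11/4, along which the vertex
  region borders the ridge region. The constant in the proof is 9 * 39^7, proportional to (s +
  t)^7.\<close>

lemma boundary_polynomial_pos:
  fixes p :: real
  assumes "21/10 \<le> p" "p \<le> 6"
  shows "p * (24 * p - 5 - p\<^sup>2 - (3 * p - 11/2)\<^sup>2 / 3) ^ 3 < 1080 * (4 * p - 5) * (9 * p\<^sup>2 - (3 * p - 11/2)\<^sup>2)"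
proof -
  define s where "s = p - 21/10"
  define t where "t = 39/10 - s"
  have st: "s \<ge> 0" "t \<ge> 0" "s + t > 0" and p: "p = s + 21/10"
    using assms by (auto simp: s_def t_def)
  have "1235079060111 * (1080 * (4 * p - 5) * (9 * p\<^sup>2 - (3 * p - 11/2)\<^sup>2) - p * (24 * p - 5 - p\<^sup>2 - (3 * p - 11/2)\<^sup>2 / 3) ^ 3)
    = 90882626641 * t ^ 7
      + 11665221055820 * s * t ^ 6
      + 79831112970825 * s ^ 2 * t ^ 5
      + 249651939027500 * s ^ 3 * t ^ 4
      + 763964583416875 * s ^ 4 * t ^ 3
      + 1434086638762500 * s ^ 5 * t ^ 2
      + 1010991881546875 * s ^ 6 * t
      + 238519721562500 * s ^ 7"
    unfolding p t_def by algebra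
  moreover have "\<dots> > 0"
  proof (cases "s = 0")
    case True
    with st show ?thesis by simp
  next
    case False
    with st show ?thesis by (auto intro!: add_nonneg_pos)
  qed
  ultimately show ?thesis by simp
qed

section \<open>The bound 10, region by region\<close>

text \<open>The choice k = 15 + R cancels R in the shifted values, which become 24 w + 10 at a
  vertex with component w and 40 at the centroid. The three parabola bounds then average to 10 + (32
  R - 150) / (4 k), which is below 10 exactly for R < 75/16.\<close>

lemma cone_mean_near_centroid:
  fixes p d :: real
  defines "R \<equiv> p\<^sup>2 + d\<^sup>2 / 3"
  assumes "R < 75/16"
  shows "cone_mean (24 * p - 5 - R) (12 * (d - p) - 5 - R) (- 12 * (p + d) - 5 - R) < ennreal 10"
proof -
  define a b c m k where "a = 24 * p - 5 - R" and "b = 12 * (d - p) - 5 - R"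
    and "c = - 12 * (p + d) - 5 - R" and "m = 25 - R" and "k = 15 + R"
  note defs = a_def b_def c_def m_def k_def
  have R: "R \<ge> 0" by (simp add: R_def)
  then have k: "k > 0" by (simp add: k_def)
  let ?Q = "\<lambda>x y z. ((x + k)\<^sup>2 + (y + k)\<^sup>2 + (z + k)\<^sup>2 + (x + y + z + 3 * k)\<^sup>2) / (48 * k)"
  have "cone_mean a b c \<le> ennreal ((?Q a b m + ?Q a c m + ?Q b c m) / 3)"
  proof (rule cone_mean_trisect_le[where m=m])
    show "m = (a + b + c) / 3 + 30" by (simp add: defs field_simps)
  qed (use k in \<open>simp_all add: affine_mean_quadratic\<close>)
  also have "\<dots> < ennreal 10"
  proof (rule ennreal_lessI)
    have eq: "(?Q a b m + ?Q a c m + ?Q b c m) / 3 = 10 + (32 * R - 150) / (4 * k)"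
    proof -
      have d: "d\<^sup>2 = 3 * (R - p\<^sup>2)" by (simp add: R_def)
      have "((a + k)\<^sup>2 + (b + k)\<^sup>2 + (m + k)\<^sup>2 + (a + b + m + 3 * k)\<^sup>2)
        + ((a + k)\<^sup>2 + (c + k)\<^sup>2 + (m + k)\<^sup>2 + (a + c + m + 3 * k)\<^sup>2)
        + ((b + k)\<^sup>2 + (c + k)\<^sup>2 + (m + k)\<^sup>2 + (b + c + m + 3 * k)\<^sup>2) = 36 * (40 * k + (32 * R - 150))"
        using d unfolding defs by algebra
      moreover have "(X / (48 * k) + Y / (48 * k) + Z / (48 * k)) / 3 = (X + Y + Z) / (144 * k)" for X Y Z
        by (simp add: add_divide_distrib)
      moreover have "36 * (40 * k + e) / (144 * k) = 10 + e / (4 * k)" for e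
        using k by (simp add: field_simps)
      ultimately show ?thesis by (simp only:)
    qed
    have "(32 * R - 150) / (4 * k) < 0"
      using k assms(2) by (simp add: divide_less_0_iff)
    then show "(?Q a b m + ?Q a c m + ?Q b c m) / 3 < 10" unfolding eq by simp
  qed simp
  finally show ?thesis by (simp add: defs)
qed

text \<open>Both halves of the bisected triangle have the first vertex as a corner, and there the
  wedge bound applies: the inequalities for p and d say that its value exceeds those at the other
  two vertices and at the midpoint. For p = 5 and d = 0 the result is exactly 10.\<close>

lemma cone_mean_near_vertex:
  fixes p d :: real
  defines "R \<equiv> p\<^sup>2 + d\<^sup>2 / 3" and "y \<equiv> 24 * p - 5 - (p\<^sup>2 + d\<^sup>2 / 3)"
  assumes "p > 5/4" "0 \<le> d" "d < 3 * p"
  shows "cone_mean (24 * p - 5 - R) (12 * (d - p) - 5 - R) (- 12 * (p + d) - 5 - R)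
    \<le> ennreal (p * max 0 y ^ 3 / (108 * (4 * p - 5) * (9 * p\<^sup>2 - d\<^sup>2)))"
proof -
  define b c m where "b = 12 * (d - p) - 5 - R"
    and "c = - 12 * (p + d) - 5 - R" and "m = (b + c) / 2 + 45"
  have y: "y = 24 * p - 5 - R" by (simp add: y_def R_def)
  have diffs: "y - b = 12 * (3 * p - d)" "y - c = 12 * (3 * p + d)" "y - m = 9 * (4 * p - 5)"
    by (simp_all add: y b_def c_def m_def field_simps)
  define Y where "Y = max 0 y ^ 3"
  have less: "b < y" "c < y" "m < y"
  proof -
    have "0 < y - b" "0 < y - c" "0 < y - m"
      unfolding diffs using assms(3-) by simp_all
    then show "b < y" "c < y" "m < y" by simp_all
  qed
  have "cone_mean y b c \<le> ennreal (1/2) * (affine_mean y b m + affine_mean y c m)"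
    by (rule cone_mean_bisect) (rule m_def)
  also have "\<dots> \<le> ennreal (1/2) * (ennreal (Y / (3 * (y - b) * (y - m))) + ennreal (Y / (3 * (y - c) * (y - m))))"
    unfolding Y_def using less by (intro mult_left_mono add_mono affine_mean_wedge) auto
  also have "\<dots> = ennreal (1/2 * (Y / (3 * (y - b) * (y - m)) + Y / (3 * (y - c) * (y - m))))"
  proof -
    have "ennreal (1/2) * (ennreal A + ennreal B) = ennreal (1/2 * (A + B))" if "0 \<le> A" "0 \<le> B" for A B
      using that by (subst ennreal_plus[symmetric], simp, simp, subst ennreal_mult) auto
    moreover have "0 \<le> Y / (3 * (y - b) * (y - m))" "0 \<le> Y / (3 * (y - c) * (y - m))"
      using less by (simp_all add: Y_def)
    ultimately show ?thesis by blast
  qed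
  also have "1/2 * (Y / (3 * (y - b) * (y - m)) + Y / (3 * (y - c) * (y - m))) = p * Y / (108 * (4 * p - 5) * (9 * p\<^sup>2 - d\<^sup>2))"
  proof -
    have "3 * p - d \<noteq> 0" "3 * p + d \<noteq> 0" "4 * p - 5 \<noteq> 0" using assms(3-) by auto
    moreover have "9 * p\<^sup>2 - d\<^sup>2 = (3 * p - d) * (3 * p + d)" by (simp add: power2_eq_square algebra_simps)
    ultimately show ?thesis
      unfolding diffs by (simp add: divide_simps) (simp add: algebra_simps)
  qed
  finally show ?thesis by (simp add: y b_def c_def Y_def)
qed

text \<open>The case d = 0 of the vertex estimate. At p = 5, the center itself, equality holds, and
  p = 5 is a double root of the slack; the remaining quartic is positive.\<close>

lemma vertex_polynomial_pos:
  fixes p :: real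
  assumes "21/10 \<le> p" "p \<noteq> 5"
  shows "(24 * p - 5 - p\<^sup>2) ^ 3 < 9720 * p * (4 * p - 5)"
proof -
  have "0 < p ^ 4 - 62 * p ^ 3 + 1098 * p\<^sup>2 - 2014 * p + 5"
  proof (cases "p \<le> 15")
    case True
    define s where "s = p - 21/10"
    have s: "0 \<le> s" "s \<le> 129/10" using assms(1) True by (auto simp: s_def)
    have "p ^ 4 - 62 * p ^ 3 + 1098 * p\<^sup>2 - 2014 * p + 5
      = s ^ 4 + s\<^sup>2 * (36693/50 - 268/5 * s) + 226798/125 * s + 630461/10000"
      unfolding s_def by algebra
    moreover have "0 \<le> s\<^sup>2 * (36693/50 - 268/5 * s)" "0 \<le> s ^ 4" using s by auto
    ultimately show ?thesis using s by linarith
  next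
    case False
    have "p ^ 4 - 62 * p ^ 3 + 1098 * p\<^sup>2 - 2014 * p + 5 = (p * (p - 31))\<^sup>2 + p * (137 * p - 2014) + 5"
      by algebra
    moreover have "0 \<le> p * (137 * p - 2014)" "0 \<le> (p * (p - 31))\<^sup>2" using False by simp_all
    ultimately show ?thesis by linarith
  qed
  then have "0 < (p - 5)\<^sup>2 * (p ^ 4 - 62 * p ^ 3 + 1098 * p\<^sup>2 - 2014 * p + 5)"
    using assms(2) by simp
  moreover have "9720 * p * (4 * p - 5) - (24 * p - 5 - p\<^sup>2) ^ 3
    = (p - 5)\<^sup>2 * (p ^ 4 - 62 * p ^ 3 + 1098 * p\<^sup>2 - 2014 * p + 5)"
    by algebra
  ultimately show ?thesis by simp
qed

lemma cube_convex:
  fixes a b t :: real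
  assumes "0 \<le> a" "0 \<le> b" "0 \<le> t" "t \<le> 1"
  shows "((1 - t) * a + t * b) ^ 3 \<le> (1 - t) * a ^ 3 + t * b ^ 3"
proof -
  have "(1 - t) * a ^ 3 + t * b ^ 3 - ((1 - t) * a + t * b) ^ 3
    = t * (1 - t) * (a - b)\<^sup>2 * ((2 - t) * a + (1 + t) * b)"
    by algebra
  moreover have "\<dots> \<ge> 0" using assms by simp
  ultimately show ?thesis by linarith
qed

text \<open>The slack is concave in \<open>d\<^sup>2\<close> while \<open>y \<ge> 0\<close>, so for \<open>p \<le> 6\<close> it suffices to check \<open>d = 0\<close> and \<open>d = 3 p - 11/2\<close>.\<close>

lemma vertex_inequality:
  fixes p d :: real
  defines "y \<equiv> 24 * p - 5 - (p\<^sup>2 + d\<^sup>2 / 3)"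
  assumes "21/10 \<le> p" "0 \<le> d" "d \<le> 3 * p - 11/2" "p \<noteq> 5 \<or> d \<noteq> 0"
  shows "p * max 0 y ^ 3 < 1080 * (4 * p - 5) * (9 * p\<^sup>2 - d\<^sup>2)"
proof (cases "y > 0")
  case False
  have "d\<^sup>2 < (3 * p)\<^sup>2" using assms(2-) by (intro power_strict_mono) auto
  then show ?thesis using False assms(2) by (auto simp: max_def power_mult_distrib)
next
  case True
  define y0 where "y0 = 24 * p - 5 - p\<^sup>2"
  have yy0: "y = y0 - d\<^sup>2 / 3" by (simp add: y_def y0_def)
  have "0 \<le> d\<^sup>2 / 3" by simp
  with True yy0 have y0: "0 < y0" by linarith
  have at0: "y0 ^ 3 \<le> 9720 * p * (4 * p - 5)" "p \<noteq> 5 \<Longrightarrow> y0 ^ 3 < 9720 * p * (4 * p - 5)"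
  proof -
    show "p \<noteq> 5 \<Longrightarrow> y0 ^ 3 < 9720 * p * (4 * p - 5)"
      unfolding y0_def using vertex_polynomial_pos assms(2) by blast
    then show "y0 ^ 3 \<le> 9720 * p * (4 * p - 5)"
      by (cases "p = 5") (auto simp: y0_def)
  qed
  have "p * y ^ 3 < 1080 * (4 * p - 5) * (9 * p\<^sup>2 - d\<^sup>2)"
  proof (cases "d = 0")
    case True
    then have "y ^ 3 < 9720 * p * (4 * p - 5)" using at0(2) assms(5) yy0 by simp
    then have "p * y ^ 3 < p * (9720 * p * (4 * p - 5))" using assms(2) by (intro mult_strict_left_mono) auto
    then show ?thesis using True by (simp add: power2_eq_square algebra_simps)
  next
    case d: False
    show ?thesis
    proof (cases "p \<le> 6")
      case True
      \<comment> \<open>Both y and the right-hand side are affine in d^2, so they are interpolated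
        between d^2 = 0 and d^2 = D with weight t, and convexity of the cube does the rest. This
        needs a nonnegative end value \<open>y1\<close>, hence p \<le> 6.\<close>
      define D where "D = (3 * p - 11/2)\<^sup>2"
      define t where "t = d\<^sup>2 / D"
      define y1 where "y1 = y0 - D / 3"
      have dD: "d\<^sup>2 \<le> D" unfolding D_def using assms(2-) by (intro power_mono) auto
      moreover have "0 < d\<^sup>2" using d by simp
      ultimately have D: "D > 0" by linarith
      have t: "0 < t" "t \<le> 1" "d\<^sup>2 = t * D" using D dD d by (auto simp: t_def)
      have y1: "0 \<le> y1"
      proof -
        have "y1 = 4 * ((p - 21/10) * (6 - p)) + 13/5 * p + 504/10 - 181/12"
          unfolding y1_def y0_def D_def by algebra
        moreover have "0 \<le> (p - 21/10) * (6 - p)" using assms(2) True by simp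
        ultimately show ?thesis using assms(2) by linarith
      qed
      have "y = (1 - t) * y0 + t * y1" by (simp add: yy0 y1_def t(3) algebra_simps)
      then have "p * y ^ 3 \<le> p * ((1 - t) * y0 ^ 3 + t * y1 ^ 3)"
        using cube_convex[of y0 y1 t] y0 y1 t assms(2) by (intro mult_left_mono) auto
      also have "\<dots> = (1 - t) * (p * y0 ^ 3) + t * (p * y1 ^ 3)" by (simp add: algebra_simps)
      also have "\<dots> < (1 - t) * (p * (9720 * p * (4 * p - 5))) + t * (1080 * (4 * p - 5) * (9 * p\<^sup>2 - D))"
      proof (rule add_le_less_mono)
        show "(1 - t) * (p * y0 ^ 3) \<le> (1 - t) * (p * (9720 * p * (4 * p - 5)))"
          using t assms(2) at0 by (intro mult_left_mono) auto
        show "t * (p * y1 ^ 3) < t * (1080 * (4 * p - 5) * (9 * p\<^sup>2 - D))"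
          using boundary_polynomial_pos[OF assms(2) True] t
          by (intro mult_strict_left_mono) (auto simp: y1_def y0_def D_def)
      qed
      also have "\<dots> = 1080 * (4 * p - 5) * (9 * p\<^sup>2 - d\<^sup>2)"
        unfolding t(3) by (simp add: power2_eq_square algebra_simps)
      finally show ?thesis .
    next
      case False
      \<comment> \<open>For large p the case d = 0 is transported directly: this inequality gives y
        \<le> y0 (1 - d^2 / (9 p^2)), so y^3 \<le> y0^2 y picks up the factor by which the
        right-hand side shrinks.\<close>
      have "y0 \<le> 3 * p\<^sup>2"
      proof -
        have "3 * p\<^sup>2 - y0 = 4 * p * (p - 6) + 5" by (simp add: y0_def power2_eq_square algebra_simps)
        also have "\<dots> \<ge> 0" using False by simp
        finally show ?thesis by simp
      qed
      have "p * y ^ 3 = p * (y\<^sup>2 * y)" by (simp add: power2_eq_square power3_eq_cube)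
      also have "\<dots> \<le> p * (y0\<^sup>2 * y)"
        using \<open>y > 0\<close> assms(2) yy0 by (intro mult_left_mono mult_right_mono power_mono) auto
      finally have "9 * p\<^sup>2 * (p * y ^ 3) \<le> 9 * p\<^sup>2 * (p * (y0\<^sup>2 * y))" by (rule mult_left_mono) simp
      also have "\<dots> = p * y0\<^sup>2 * (9 * p\<^sup>2 * y)" by simp
      also have "\<dots> \<le> p * y0\<^sup>2 * (y0 * (9 * p\<^sup>2 - d\<^sup>2))"
      proof -
        have "y0 * d\<^sup>2 \<le> 3 * p\<^sup>2 * d\<^sup>2" using \<open>y0 \<le> 3 * p\<^sup>2\<close> by (intro mult_right_mono) auto
        then have "9 * p\<^sup>2 * y \<le> y0 * (9 * p\<^sup>2 - d\<^sup>2)" by (simp add: yy0 algebra_simps)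
        then show ?thesis using assms(2) by (intro mult_left_mono) auto
      qed
      also have "\<dots> = p * (9 * p\<^sup>2 - d\<^sup>2) * y0 ^ 3" by (simp add: power2_eq_square power3_eq_cube)
      also have "\<dots> < p * (9 * p\<^sup>2 - d\<^sup>2) * (9720 * p * (4 * p - 5))"
      proof -
        have "d\<^sup>2 < (3 * p)\<^sup>2" using assms(2-) by (intro power_strict_mono) auto
        then show ?thesis using at0(2) False assms(2) by (intro mult_strict_left_mono) (auto simp: power_mult_distrib)
      qed
      finally have "9 * p\<^sup>2 * (p * y ^ 3) < 9 * p\<^sup>2 * (1080 * (4 * p - 5) * (9 * p\<^sup>2 - d\<^sup>2))"
        by (simp add: power2_eq_square algebra_simps)
      then show ?thesis using assms(2) by (simp add: mult_less_cancel_left)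
    qed
  qed
  then show ?thesis using True by simp
qed

text \<open>The piece between the two favored vertices and the centroid gets the parabola with k =
  20; the two pieces at the unfavored vertex get half strips running towards it. The constant 599/20
  lies just below 30, so a nonnegative slack already gives a strict bound.\<close>

lemma cone_mean_near_ridge:
  fixes \<rho> u :: real
  defines "R \<equiv> \<rho>\<^sup>2 + u\<^sup>2 / 3"
  assumes "7/5 \<le> \<rho>" "\<rho> \<le> 41/4" "0 \<le> u" "u \<le> 11/4"
  shows "cone_mean (12 * \<rho> + 12 * u - 5 - R) (12 * \<rho> - 12 * u - 5 - R) (- 24 * \<rho> - 5 - R) < ennreal 10"
proof -
  define a b c m where "a = 12 * \<rho> + 12 * u - 5 - R" and "b = 12 * \<rho> - 12 * u - 5 - R"
    and "c = - 24 * \<rho> - 5 - R" and "m = 25 - R"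
  note defs = a_def b_def c_def m_def
  define X where "X = 36 * (3 * \<rho> + u)"
  define Y where "Y = 18 * (5 + 4 * \<rho>)"
  define A where "A = ((a + 20)\<^sup>2 + (b + 20)\<^sup>2 + (m + 20)\<^sup>2 + (a + b + m + 3 * 20)\<^sup>2) / (48 * 20)"
  define B where "B = (m\<^sup>2 + m * a + a\<^sup>2) / X"
  define C where "C = (b\<^sup>2 + b * m + m\<^sup>2) / Y"
  have pos: "X > 0" "Y > 0" using assms(2-) by (auto simp: X_def Y_def)
  have X: "X = 3 * (a - c)" and Y: "Y = 3 * (m - c)" by (auto simp: X_def Y_def defs)
  have nonneg: "0 \<le> x\<^sup>2 + x * y + y\<^sup>2" for x y :: real
  proof -
    have "x\<^sup>2 + x * y + y\<^sup>2 = (x + y / 2)\<^sup>2 + 3 / 4 * y\<^sup>2" by (simp add: power2_eq_square field_simps)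
    then show ?thesis by simp
  qed
  have "cone_mean a b c \<le> ennreal ((A + B + C) / 3)"
  proof (rule cone_mean_trisect_le[where m=m])
    show "m = (a + b + c) / 3 + 30" by (simp add: defs field_simps)
    show "affine_mean a b m \<le> ennreal A" unfolding A_def by (rule affine_mean_quadratic) simp
    have "affine_mean a c m = affine_mean m a c" by (metis affine_mean_swap12 affine_mean_swap23)
    also have "\<dots> \<le> ennreal B" unfolding B_def X by (rule affine_mean_strip) (use X pos in simp)
    finally show "affine_mean a c m \<le> ennreal B" .
    have "affine_mean b c m = affine_mean b m c" by (rule affine_mean_swap23)
    also have "\<dots> \<le> ennreal C" unfolding C_def Y by (rule affine_mean_strip) (use Y pos in simp)
    finally show "affine_mean b c m \<le> ennreal C" .
    show "0 \<le> A" by (simp add: A_def)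
    show "0 \<le> B" "0 \<le> C" unfolding B_def C_def using pos by (intro divide_nonneg_pos nonneg; simp)+
  qed
  also have "\<dots> < ennreal 10"
  proof (rule ennreal_lessI)
    have "0 \<le> ridge_polynomial \<rho> u"
      using assms(2-) by (intro ridge_polynomial_nonneg)
    also have "ridge_polynomial \<rho> u = (599/20 - A) * X * Y - (m\<^sup>2 + m * a + a\<^sup>2) * Y - (b\<^sup>2 + b * m + m\<^sup>2) * X"
      by (simp add: ridge_polynomial_def Let_def A_def X_def Y_def defs R_def algebra_simps)
    also have "\<dots> = (599/20 - (A + B + C)) * (X * Y)"
      using pos by (simp add: B_def C_def field_simps)
    finally have "0 \<le> 599/20 - (A + B + C)"
      using pos by (intro mult_right_le_imp_le[of 0 "X * Y"]) auto
    then show "(A + B + C) / 3 < 10" by simp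
  qed simp
  finally show ?thesis by (simp add: defs)
qed

text \<open>Far out only the values at the two favored vertices can be positive. Each occurs in two
  of the three pieces, so their positive parts need only sum to less than 45.\<close>

lemma cone_mean_far:
  fixes \<rho> u :: real
  defines "R \<equiv> \<rho>\<^sup>2 + u\<^sup>2 / 3"
  assumes "41/4 \<le> \<rho>" "0 \<le> u" "u \<le> 11/4"
  shows "cone_mean (12 * \<rho> + 12 * u - 5 - R) (12 * \<rho> - 12 * u - 5 - R) (- 24 * \<rho> - 5 - R) < ennreal 10"
proof -
  define a b c m where "a = 12 * \<rho> + 12 * u - 5 - R" and "b = 12 * \<rho> - 12 * u - 5 - R"
    and "c = - 24 * \<rho> - 5 - R" and "m = 25 - R"
  note defs = a_def b_def c_def m_def
  let ?V = "\<lambda>x y z. (max 0 x + max 0 y + max 0 z) / 3 :: real"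
  have "cone_mean a b c \<le> ennreal ((?V a b m + ?V a c m + ?V b c m) / 3)"
  proof (rule cone_mean_trisect_le[where m=m])
    show "m = (a + b + c) / 3 + 30" by (simp add: defs field_simps)
  qed (simp_all add: affine_mean_vertices)
  also have "\<dots> < ennreal 10"
  proof (rule ennreal_lessI)
    have "(\<rho> - 41/4) * (\<rho> - 7/4) \<ge> 0" using assms(2) by simp
    then have 1: "\<rho>\<^sup>2 \<ge> 12 * \<rho> - 287/16" by (simp add: power2_eq_square field_simps)
    have "(11/4 - u) * (12 - (11/4 + u) / 3) \<ge> 0" using assms(3,4) by simp
    then have 2: "12 * u - u\<^sup>2 / 3 \<le> 1463/48" by (simp add: power2_eq_square field_simps)
    have 3: "0 \<le> u\<^sup>2" "0 \<le> \<rho>\<^sup>2" by simp_all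
    have "a < 45" "a + b < 45"
      unfolding defs R_def using 1 2 3 by linarith+
    moreover have "b < 45" using assms(3) calculation by (simp add: defs)
    moreover have "m \<le> 0"
      unfolding defs R_def using 1 3 assms(2) by linarith
    moreover have "c \<le> 0" unfolding defs R_def using assms(2) 3 by linarith
    ultimately have "max 0 a + max 0 b < 45" "max 0 m = 0" "max 0 c = 0"
      by (auto simp: max_def)
    moreover have "(x + y + z) / 3 + (x + w + z) / 3 + (y + w + z) / 3 < 30"
      if "x + y < 45" "z = 0" "w = 0" for x y z w :: real
      using that by argo
    ultimately show "(?V a b m + ?V a c m + ?V b c m) / 3 < 10"
      by (simp del: add_divide_distrib)
  qed simp
  finally show ?thesis by (simp add: defs)
qed

text \<open>The constraints on d say that the components p, (d - p) / 2, - (p + d) / 2 are in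
  decreasing order. The line d = 3 p is the bisector of the first two vertex directions. Outside the
  disc R < 75/16, the strip u < 11/4 along it belongs to the ridge and far estimates, the rest to
  the vertex estimate.\<close>

lemma cone_mean_sorted:
  fixes p d :: real
  defines "R \<equiv> p\<^sup>2 + d\<^sup>2 / 3"
  defines "C \<equiv> cone_mean (24 * p - 5 - R) (12 * (d - p) - 5 - R) (- 12 * (p + d) - 5 - R)"
  assumes "0 \<le> d" "d \<le> 3 * p"
  shows "C < ennreal 10 \<or> p = 5 \<and> d = 0" "C \<le> ennreal 10"
proof -
  have *: "C < ennreal 10 \<or> p = 5 \<and> d = 0 \<and> C \<le> ennreal 10"
  proof (cases "R < 75/16")
    case True
    then show ?thesis unfolding C_def R_def using cone_mean_near_centroid by auto
  next
    case R: False
    show ?thesis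
    proof (cases "d \<le> 3 * p - 11/2")
      case True
      \<comment> \<open>Otherwise d \<le> 4/5, and R \<le> 441/100 + 16/75 < 75/16.\<close>
      have p: "21/10 \<le> p"
      proof (rule ccontr)
        assume "\<not> 21/10 \<le> p"
        with True assms(3) have "p\<^sup>2 \<le> (21/10)\<^sup>2" "d\<^sup>2 \<le> (4/5)\<^sup>2" by (auto intro!: power_mono)
        then show False using R by (simp add: R_def power2_eq_square)
      qed
      define y where "y = 24 * p - 5 - (p\<^sup>2 + d\<^sup>2 / 3)"
      define Z where "Z = (4 * p - 5) * (9 * p\<^sup>2 - d\<^sup>2)"
      have "d\<^sup>2 < (3 * p)\<^sup>2" using True assms(3) by (intro power_strict_mono) auto
      then have Z: "Z > 0" using p by (auto simp: Z_def power_mult_distrib)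
      have le: "C \<le> ennreal (p * max 0 y ^ 3 / (108 * Z))"
        unfolding C_def R_def y_def Z_def
        using cone_mean_near_vertex[OF _ assms(3), of p] p True by (simp only: mult.assoc)
      show ?thesis
      proof (cases "p = 5 \<and> d = 0")
        case False
        then have "p * max 0 y ^ 3 < 1080 * Z"
          unfolding y_def Z_def using vertex_inequality[OF p assms(3) True] by (simp only: mult.assoc) blast
        then have "p * max 0 y ^ 3 / (108 * Z) < 10" using Z by (simp add: divide_simps)
        then show ?thesis using le by (meson ennreal_lessI le_less_trans zero_less_numeral)
      next
        case True
        then show ?thesis using le by (simp add: y_def Z_def)
      qed
    next
      case False
      define \<rho> u where "\<rho> = (p + d) / 2" and "u = (3 * p - d) / 2"
      have u: "0 \<le> u" "u \<le> 11/4" using assms(4) False by (auto simp: u_def)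
      have R': "R = \<rho>\<^sup>2 + u\<^sup>2 / 3" by (simp add: R_def \<rho>_def u_def power2_eq_square field_simps)
      have "0 \<le> \<rho>" using assms(3,4) by (simp add: \<rho>_def)
      \<comment> \<open>Otherwise R \<le> 49/25 + 121/48 < 75/16.\<close>
      have "7/5 \<le> \<rho>"
      proof (rule ccontr)
        assume "\<not> 7/5 \<le> \<rho>"
        with u \<open>0 \<le> \<rho>\<close> have "\<rho>\<^sup>2 \<le> (7/5)\<^sup>2" "u\<^sup>2 \<le> (11/4)\<^sup>2" by (auto intro!: power_mono)
        then show False using R unfolding R' by (simp add: power2_eq_square)
      qed
      have C: "C = cone_mean (12 * \<rho> + 12 * u - 5 - R) (12 * \<rho> - 12 * u - 5 - R) (- 24 * \<rho> - 5 - R)"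
      proof -
        have "12 * \<rho> + 12 * u = 24 * p" "12 * \<rho> - 12 * u = 12 * (d - p)" "- 24 * \<rho> = - 12 * (p + d)"
          by (simp_all add: \<rho>_def u_def field_simps)
        then show ?thesis by (simp only: C_def)
      qed
      have "C < ennreal 10"
      proof (cases "\<rho> \<le> 41/4")
        case True
        then show ?thesis unfolding C R' using cone_mean_near_ridge[OF \<open>7/5 \<le> \<rho>\<close> True u] by simp
      next
        case False
        then show ?thesis unfolding C R' using cone_mean_far[of \<rho> u] u by simp
      qed
      then show ?thesis ..
    qed
  qed
  then show "C < ennreal 10 \<or> p = 5 \<and> d = 0" "C \<le> ennreal 10" by auto
qed

lemma cone_mean_le:
  fixes u v w :: real
  assumes "u + v + w = 0"
  defines "f \<equiv> \<lambda>x. 24 * x - 5 - 2/3 * (u\<^sup>2 + v\<^sup>2 + w\<^sup>2)"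
  shows "cone_mean (f u) (f v) (f w) < ennreal 10 \<or> (u = 5 \<and> v = -5/2) \<or> (v = 5 \<and> w = -5/2) \<or> (w = 5 \<and> u = -5/2)"
    and "cone_mean (f u) (f v) (f w) \<le> ennreal 10"
proof -
  \<comment> \<open>Both claims are packed into a predicate invariant under permutations, so two
    transpositions reduce all six orderings to the sorted one.\<close>
  define P where "P u v w = (let f = \<lambda>x. 24 * x - 5 - 2/3 * (u\<^sup>2 + v\<^sup>2 + w\<^sup>2); C = cone_mean (f u) (f v) (f w)
    in (C < ennreal 10 \<or> (u, v, w) \<in> {(5, -5/2, -5/2), (-5/2, 5, -5/2), (-5/2, -5/2, 5)}) \<and> C \<le> ennreal 10)" for u v w :: real
  have swap12: "P u v w = P v u w" for u v w
  proof -
    have s: "v\<^sup>2 + u\<^sup>2 + w\<^sup>2 = u\<^sup>2 + v\<^sup>2 + w\<^sup>2" by simp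
    show ?thesis unfolding P_def Let_def s
        cone_mean_swap12[of "24 * v - 5 - 2/3 * (u\<^sup>2 + v\<^sup>2 + w\<^sup>2)" "24 * u - 5 - 2/3 * (u\<^sup>2 + v\<^sup>2 + w\<^sup>2)"]
      by auto
  qed
  have swap23: "P u v w = P u w v" for u v w
  proof -
    have s: "u\<^sup>2 + w\<^sup>2 + v\<^sup>2 = u\<^sup>2 + v\<^sup>2 + w\<^sup>2" by simp
    show ?thesis unfolding P_def Let_def s
        cone_mean_swap23[of _ "24 * w - 5 - 2/3 * (u\<^sup>2 + v\<^sup>2 + w\<^sup>2)" "24 * v - 5 - 2/3 * (u\<^sup>2 + v\<^sup>2 + w\<^sup>2)"]
      by auto
  qed
  have sorted: "P u v w" if "u + v + w = 0" "w \<le> v" "v \<le> u" for u v w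
  proof -
    define d where "d = v - w"
    have v: "v = (d - u) / 2" and w: "w = - (u + d) / 2" using that(1) by (auto simp: d_def)
    have d: "0 \<le> d" "d \<le> 3 * u" using that by (auto simp: d_def)
    have R: "2/3 * (u\<^sup>2 + v\<^sup>2 + w\<^sup>2) = u\<^sup>2 + d\<^sup>2 / 3"
      unfolding v w by (simp add: power2_eq_square field_simps)
    have args: "24 * v - 5 - (u\<^sup>2 + d\<^sup>2 / 3) = 12 * (d - u) - 5 - (u\<^sup>2 + d\<^sup>2 / 3)"
      "24 * w - 5 - (u\<^sup>2 + d\<^sup>2 / 3) = - 12 * (u + d) - 5 - (u\<^sup>2 + d\<^sup>2 / 3)"
      unfolding v w by (simp_all add: field_simps)
    have eq: "(u, v, w) = (5, -5/2, -5/2)" if "u = 5 \<and> d = 0"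
      using that v w by simp
    show ?thesis
      unfolding P_def Let_def R args using cone_mean_sorted[OF d] eq by auto
  qed
  have "P u v w"
  proof -
    consider "w \<le> v" "v \<le> u" | "v \<le> w" "w \<le> u" | "w \<le> u" "u \<le> v" | "u \<le> w" "w \<le> v" | "v \<le> u" "u \<le> w" | "u \<le> v" "v \<le> w"
      by linarith
    then show ?thesis
    proof cases
      case 1
      with assms(1) show ?thesis by (simp add: sorted)
    next
      case 2
      with assms(1) have "P u w v" by (simp add: sorted)
      then show ?thesis by (simp only: swap23[of u v w])
    next
      case 3
      with assms(1) have "P v u w" by (simp add: sorted)
      then show ?thesis by (simp only: swap12[of u v w])
    next
      case 4
      with assms(1) have "P v w u" by (simp add: sorted)
      then show ?thesis by (simp only: swap12[of u v w] swap23[of v u w])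
    next
      case 5
      with assms(1) have "P w u v" by (simp add: sorted)
      then show ?thesis by (simp only: swap23[of u v w] swap12[of u w v])
    next
      case 6
      with assms(1) have "P w v u" by (simp add: sorted)
      then show ?thesis by (simp only: swap12[of u v w] swap23[of v u w] swap12[of v w u])
    qed
  qed
  then show "cone_mean (f u) (f v) (f w) < ennreal 10 \<or> (u = 5 \<and> v = -5/2) \<or> (v = 5 \<and> w = -5/2) \<or> (w = 5 \<and> u = -5/2)"
    "cone_mean (f u) (f v) (f w) \<le> ennreal 10"
    by (auto simp: P_def Let_def f_def)
qed

section \<open>Attainment of the value 10 at the centers\<close>

text \<open>The two closed halves of the triangle share a median. Adding their contributions for a
  lower bound counts it twice, so it has to be null.\<close>

lemma simplex_mean_diagonal:
  assumes F: "measurable3 F"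
  shows "simplex_mean (\<lambda>x y z. F x y z * (if y = z then 1 else 0)) = 0"
proof -
  have m: "measurable3 (\<lambda>x y z. F x y z * (if y = z then 1 else 0))"
    by (intro measurable3_restrict F closed_Collect_eq continuous_intros)
  have "simplex_mean (\<lambda>x y z. F x y z * (if y = z then 1 else 0))
    = (\<integral>\<^sup>+s. \<integral>\<^sup>+t. 2 * (F (1 - s - t) s t * (if s = t then 1 else 0)) * indicator simplex_set (s, t) \<partial>lborel \<partial>lborel)"
    unfolding simplex_mean_def
    by (subst nn_integral_plane_iterated[OF simplex_mean_integrand_measurable[OF m]]) simp
  also have "\<dots> = (\<integral>\<^sup>+s. \<integral>\<^sup>+(t::real). 0 \<partial>lborel \<partial>(lborel :: real measure))"
    by (intro nn_integral_cong nn_integral_cong_AE, rule AE_mp[OF AE_lborel_singleton]) auto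
  finally show ?thesis by simp
qed

text \<open>At a center the components are 5, -5/2, -5/2 and R = 25, whence the vertex values 90,
  -90, -90. Each half contributes 5 by the exact corner formula with midpoint value -45; replacing
  the smallest coordinate by the smaller of the last two matters only where the function is
  nonpositive.\<close>

lemma cone_mean_at_vertex: "ennreal 10 \<le> cone_mean 90 (-90) (-90)"
proof -
  let ?F = "\<lambda>x y z. ennreal (90 * x + -90 * y + -90 * z + 90 * min x (min y z))"
  let ?G = "\<lambda>x y z. ?F x y z * (if z \<le> y then 1 else 0)"
  have mG: "measurable3 ?G"
    by (intro measurable3_restrict cone_measurable3 closed_Collect_le continuous_intros)
  have mG': "measurable3 (\<lambda>x y z. ?G x z y)"
    by (intro measurable3_restrict measurable3_ennreal closed_Collect_le continuous_intros)
  have mD: "measurable3 (\<lambda>x y z. ?F x y z * (if y = z then 1 else 0))"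
    by (intro measurable3_restrict cone_measurable3 closed_Collect_eq continuous_intros)
  have half: "ennreal 5 \<le> simplex_mean ?G"
  proof -
    have "affine_mean 90 (-90) (-45) = ennreal 10"
      by (subst affine_mean_corner) auto
    moreover have "affine_mean 90 (-90) (-45) \<le> simplex_mean (\<lambda>x y z. ?F x (y + z/2) (z/2))"
      unfolding affine_mean_def
    proof (rule simplex_mean_mono)
      fix x y z :: real
      assume *: "0 \<le> x" "0 \<le> y" "0 \<le> z" "x + y + z = 1"
      show "ennreal (90 * x + -90 * y + -45 * z) \<le> ?F x (y + z/2) (z/2)"
      proof (cases "z/2 \<le> x")
        case True
        with * have min: "min x (min (y + z/2) (z/2)) = z/2" by auto
        show ?thesis unfolding min by (intro ennreal_leI) simp
      next
        case False
        with * have "90 * x + -90 * y + -45 * z \<le> 0" by simp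
        then show ?thesis by (simp add: ennreal_neg)
      qed
    qed
    ultimately have "ennreal (1/2) * ennreal 10 \<le> simplex_mean ?G"
      unfolding simplex_mean_half[OF cone_measurable3] by (intro mult_left_mono) simp_all
    then show ?thesis
      by (subst (asm) ennreal_mult[symmetric]) simp_all
  qed
  have "ennreal 10 = ennreal 5 + ennreal 5" by (subst ennreal_plus[symmetric]) auto
  also have "\<dots> \<le> simplex_mean ?G + simplex_mean (\<lambda>x y z. ?G x z y)"
    by (rule add_mono[OF half], subst simplex_mean_swap23[OF mG, symmetric], rule half)
  also have "\<dots> = simplex_mean (\<lambda>x y z. ?G x y z + ?G x z y)"
    by (rule simplex_mean_add[OF mG mG', symmetric])
  also have "\<dots> \<le> simplex_mean (\<lambda>x y z. ?F x y z + ?F x y z * (if y = z then 1 else 0))"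
  proof (rule simplex_mean_mono)
    fix x y z :: real
    have "90 * x + -90 * z + -90 * y + 90 * min x (min z y) = 90 * x + -90 * y + -90 * z + 90 * min x (min y z)"
      by (simp add: min.commute[of z y])
    then have eq: "?F x z y = ?F x y z" by (simp only:)
    have "X * (if z \<le> y then 1 else 0) + X * (if y \<le> z then 1 else 0) \<le> X + X * (if y = z then 1 else 0)" for X :: ennreal
      by (cases "z \<le> y"; cases "y \<le> z") auto
    then show "?G x y z + ?G x z y \<le> ?F x y z + ?F x y z * (if y = z then 1 else 0)"
      unfolding eq .
  qed
  also have "\<dots> = cone_mean 90 (-90) (-90)"
    unfolding simplex_mean_add[OF cone_measurable3 mD] simplex_mean_diagonal[OF cone_measurable3] cone_mean_def
    by simp
  finally show ?thesis .
qed

section \<open>The dual certificate\<close>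

lemma tri_measurable [measurable]: "tri \<in> sets borel"
  unfolding tri_def by (intro borel_compact finite_imp_compact_convex_hull) simp

lemma mem_tri_iff: "(s + t / 2, sqrt 3 / 2 * t) \<in> tri \<longleftrightarrow> (s, t) \<in> simplex_set"
proof
  assume "(s + t / 2, sqrt 3 / 2 * t) \<in> tri"
  then obtain u v w where "0 \<le> u" "0 \<le> v" "0 \<le> w" "u + v + w = 1"
    "(s + t / 2, sqrt 3 / 2 * t) = u *\<^sub>R (0, 0) + v *\<^sub>R (1, 0) + w *\<^sub>R (1/2, sqrt 3 / 2)"
    unfolding tri_def convex_hull_3 by blast
  moreover from this(5) have "t = w" "s = v" by auto
  ultimately show "(s, t) \<in> simplex_set" by (auto simp: simplex_set_def)
next
  assume "(s, t) \<in> simplex_set"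
  then have "0 \<le> 1 - s - t" "0 \<le> s" "0 \<le> t" "(1 - s - t) + s + t = 1"
    by (auto simp: simplex_set_def)
  moreover have "(s + t / 2, sqrt 3 / 2 * t) = (1 - s - t) *\<^sub>R (0, 0) + s *\<^sub>R (1, 0) + t *\<^sub>R (1/2, sqrt 3 / 2)"
    by simp
  ultimately show "(s + t / 2, sqrt 3 / 2 * t) \<in> tri"
    unfolding tri_def convex_hull_3 by blast
qed

lemma nn_integral_tri_uniform:
  assumes [measurable]: "f \<in> borel_measurable borel"
  shows "(\<integral>\<^sup>+x. f x \<partial>tri_uniform) = simplex_mean (\<lambda>x y z. f (y + z / 2, sqrt 3 / 2 * z))"
proof -
  have "(\<integral>\<^sup>+x. f x \<partial>tri_uniform) = (\<integral>\<^sup>+x. ennreal (4 / sqrt 3 * indicator tri x) * f x \<partial>lborel)"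
    unfolding tri_uniform_def by (rule nn_integral_density) measurable
  also have "\<dots> = ennreal \<bar>1 * (sqrt 3 / 2)\<bar> * (\<integral>\<^sup>+z. ennreal (4 / sqrt 3 * indicator tri (0 + 1 * fst z + (1/2) * snd z, 0 + sqrt 3 / 2 * snd z))
      * f (0 + 1 * fst z + (1/2) * snd z, 0 + sqrt 3 / 2 * snd z) \<partial>lborel)"
    by (rule nn_integral_plane_affine) auto
  also have "\<dots> = (\<integral>\<^sup>+z. ennreal \<bar>1 * (sqrt 3 / 2)\<bar> * (ennreal (4 / sqrt 3 * indicator tri (0 + 1 * fst z + (1/2) * snd z, 0 + sqrt 3 / 2 * snd z))
      * f (0 + 1 * fst z + (1/2) * snd z, 0 + sqrt 3 / 2 * snd z)) \<partial>lborel)"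
    by (rule nn_integral_cmult[symmetric]) (simp add: borel_prod[symmetric])
  also have "\<dots> = simplex_mean (\<lambda>x y z. f (y + z / 2, sqrt 3 / 2 * z))"
    unfolding simplex_mean_def
  proof (rule nn_integral_cong)
    fix z :: "real \<times> real"
    have "ennreal \<bar>1 * (sqrt 3 / 2)\<bar> * ennreal (4 / sqrt 3) = ennreal 2"
      by (subst ennreal_mult[symmetric]) auto
    then have 2: "ennreal \<bar>1 * (sqrt 3 / 2)\<bar> * (ennreal (4 / sqrt 3) * c) = 2 * c" for c
      by (simp add: mult.assoc[symmetric])
    have "(0 + 1 * fst z + (1/2) * snd z, 0 + sqrt 3 / 2 * snd z) = (fst z + snd z / 2, sqrt 3 / 2 * snd z)"
      by simp
    then show "ennreal \<bar>1 * (sqrt 3 / 2)\<bar> * (ennreal (4 / sqrt 3 * indicator tri (0 + 1 * fst z + (1/2) * snd z, 0 + sqrt 3 / 2 * snd z))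
      * f (0 + 1 * fst z + (1/2) * snd z, 0 + sqrt 3 / 2 * snd z))
      = 2 * f (fst z + snd z / 2, sqrt 3 / 2 * snd z) * indicator simplex_set z"
      using mem_tri_iff[of "fst z" "snd z"] 2
      by (cases "z \<in> simplex_set") (simp_all only: indicator_simps prod.collapse mult_1_right mult_zero_right mult_zero_left ennreal_0 simp_thms if_True not_True_eq_False not_False_eq_True)
  qed
  finally show ?thesis .
qed

text \<open>The function \<open>g\<close> of the introduction, written with the squared distance to the centroid and the barycentric
  coordinates of \<open>(x, y)\<close>.\<close>

definition certificate :: "real \<times> real \<Rightarrow> real" where
  "certificate = (\<lambda>(x, y). (x - 1/2)\<^sup>2 + (y - sqrt 3 / 6)\<^sup>2 - 5/432
     + 5/24 * min (1 - x - y * sqrt 3 / 3) (min (x - y * sqrt 3 / 3) (2 * y * sqrt 3 / 3)))"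

definition overlap :: "real \<times> real \<Rightarrow> ennreal" where
  "overlap a = (\<integral>\<^sup>+x. ennreal (certificate x - (norm (x - a))\<^sup>2) \<partial>tri_uniform)"

lemma continuous_certificate: "continuous_on UNIV certificate"
  unfolding certificate_def case_prod_unfold by (intro continuous_intros) auto

lemma certificate_measurable [measurable]: "certificate \<in> borel_measurable borel"
  by (rule borel_measurable_continuous_onI[OF continuous_certificate])

lemma norm_diff_measurable [measurable]: "(\<lambda>x. norm (x - a)) \<in> borel_measurable (borel :: (real \<times> real) measure)"
  by (intro borel_measurable_continuous_onI continuous_intros)

text \<open>The quadratic terms in the point cancel, leaving an affine function and the smallest
  coordinate. The numbers u, v, w are the components of 12 sqrt 3 (a - centroid) in the three vertex
  directions.\<close>

lemma certificate_minus_square: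
  fixes a1 a2 x y z :: real
  defines "u \<equiv> 12 - 18 * a1 - 6 * sqrt 3 * a2" and "v \<equiv> 18 * a1 - 6 - 6 * sqrt 3 * a2"
    and "w \<equiv> 12 * sqrt 3 * a2 - 6"
  defines "f \<equiv> \<lambda>x. 24 * x - 5 - 2/3 * (u\<^sup>2 + v\<^sup>2 + w\<^sup>2)"
  assumes "x + y + z = 1"
  shows "certificate (y + z / 2, sqrt 3 / 2 * z) - (norm ((y + z / 2, sqrt 3 / 2 * z) - (a1, a2)))\<^sup>2
    = 1/432 * (f u * x + f v * y + f w * z + 90 * min x (min y z))"
proof -
  have r: "(sqrt 3)\<^sup>2 = 3" by simp
  have x: "x = 1 - y - z" using assms(5) by simp
  have "q / 2 * z * q / 3 = q * q * (z / 6)" "2 * (q / 2 * z) * q / 3 = q * q * (z / 3)" for q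
    by simp_all
  from this[of "sqrt 3"]
  have *: "sqrt 3 / 2 * z * sqrt 3 / 3 = z / 2" "2 * (sqrt 3 / 2 * z) * sqrt 3 / 3 = z"
    by simp_all
  have "1 - (y + z / 2) - sqrt 3 / 2 * z * sqrt 3 / 3 = x" "y + z / 2 - sqrt 3 / 2 * z * sqrt 3 / 3 = y"
    unfolding x * by simp_all
  note this *(2)
  then have c: "certificate (y + z / 2, sqrt 3 / 2 * z) = (y + z / 2 - 1/2)\<^sup>2 + (sqrt 3 / 2 * z - sqrt 3 / 6)\<^sup>2 - 5/432
     + 5/24 * min x (min y z)"
    by (simp only: certificate_def prod.case)
  have n: "(norm ((y + z / 2, sqrt 3 / 2 * z) - (a1, a2)))\<^sup>2 = (y + z / 2 - a1)\<^sup>2 + (sqrt 3 / 2 * z - a2)\<^sup>2"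
    by (simp add: norm_Pair)
  have "432 * ((y + z / 2 - 1/2)\<^sup>2 + (sqrt 3 / 2 * z - sqrt 3 / 6)\<^sup>2 - 5/432 - ((y + z / 2 - a1)\<^sup>2 + (sqrt 3 / 2 * z - a2)\<^sup>2))
    = f u * x + f v * y + f w * z"
  proof -
    have "sqrt 3 * sqrt 3 = 3" "sqrt 3 * (sqrt 3 * c) = 3 * c" for c
      using r by (simp_all add: power2_eq_square mult.assoc[symmetric])
    then show ?thesis
      unfolding f_def u_def v_def w_def x by (simp add: power2_eq_square algebra_simps)
  qed
  then show ?thesis unfolding c n by simp
qed

lemma overlap_eq_cone_mean:
  fixes a1 a2 :: real
  defines "u \<equiv> 12 - 18 * a1 - 6 * sqrt 3 * a2" and "v \<equiv> 18 * a1 - 6 - 6 * sqrt 3 * a2"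
    and "w \<equiv> 12 * sqrt 3 * a2 - 6"
  defines "f \<equiv> \<lambda>x. 24 * x - 5 - 2/3 * (u\<^sup>2 + v\<^sup>2 + w\<^sup>2)"
  shows "overlap (a1, a2) = ennreal (1/432) * cone_mean (f u) (f v) (f w)"
proof -
  have "overlap (a1, a2) = simplex_mean (\<lambda>x y z. ennreal (1/432) * ennreal (f u * x + f v * y + f w * z + 90 * min x (min y z)))"
    unfolding overlap_def
    by (subst nn_integral_tri_uniform, measurable)
       (rule simplex_mean_cong, simp only: certificate_minus_square f_def u_def v_def w_def, simp add: ennreal_mult'[symmetric])
  then show ?thesis
    by (simp only: simplex_mean_cmult[OF cone_measurable3] cone_mean_def)
qed

definition centers :: "(real \<times> real) set" where
  "centers = {(7/24, 7 / (24 * sqrt 3)), (17/24, 7 / (24 * sqrt 3)), (1/2, 11 / (12 * sqrt 3))}"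

lemma overlap_le:
  "overlap a < ennreal (5/216) \<or> a \<in> centers"
  "overlap a \<le> ennreal (5/216)"
proof -
  obtain a1 a2 where a: "a = (a1, a2)" by fastforce
  define u v w where "u = 12 - 18 * a1 - 6 * sqrt 3 * a2" and "v = 18 * a1 - 6 - 6 * sqrt 3 * a2"
    and "w = 12 * sqrt 3 * a2 - 6"
  define C where "C = (let f = \<lambda>x. 24 * x - 5 - 2/3 * (u\<^sup>2 + v\<^sup>2 + w\<^sup>2) in cone_mean (f u) (f v) (f w))"
  have sum: "u + v + w = 0" by (simp add: u_def v_def w_def)
  have overlap: "overlap a = ennreal (1/432) * C"
    unfolding a C_def u_def v_def w_def Let_def by (rule overlap_eq_cone_mean)
  have ten: "ennreal (1/432) * ennreal 10 = ennreal (5/216)"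
    by (subst ennreal_mult[symmetric]) auto
  show "overlap a \<le> ennreal (5/216)"
    unfolding overlap ten[symmetric] C_def Let_def using cone_mean_le(2)[OF sum] by (intro mult_left_mono) auto
  have a2: "a2 = (w + 6) / (12 * sqrt 3)" and a1: "a1 = (v - u + 18) / 36"
    by (simp_all add: u_def v_def w_def field_simps)
  consider "C < ennreal 10" | "u = 5" "v = -5/2" | "v = 5" "w = -5/2" | "w = 5" "u = -5/2"
    unfolding C_def Let_def using cone_mean_le(1)[OF sum] by blast
  then show "overlap a < ennreal (5/216) \<or> a \<in> centers"
  proof cases
    case 1
    then show ?thesis
      unfolding overlap ten[symmetric] by (intro disjI1 ennreal_mult_strict_left_mono) auto
  next
    case 2
    moreover from this sum have "w = -5/2" by simp
    ultimately show ?thesis by (simp add: a a1 a2 centers_def)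
  next
    case 3
    moreover from this sum have "u = -5/2" by simp
    ultimately show ?thesis by (simp add: a a1 a2 centers_def)
  next
    case 4
    moreover from this sum have "v = -5/2" by simp
    ultimately show ?thesis by (simp add: a a1 a2 centers_def)
  qed
qed

lemma overlap_centers:
  assumes "a \<in> centers"
  shows "overlap a = ennreal (5/216)"
proof (rule antisym[OF overlap_le(2)])
  have "ennreal (5/216) = ennreal (1/432) * ennreal 10"
    by (subst ennreal_mult[symmetric]) auto
  also have "\<dots> \<le> ennreal (1/432) * cone_mean 90 (-90) (-90)"
    by (intro mult_left_mono cone_mean_at_vertex) simp
  also have "\<dots> = overlap a"
    using assms cone_mean_swap12[of 90 "-90" "-90"] cone_mean_swap23[of "-90" 90 "-90"]
    by (auto simp: centers_def overlap_eq_cone_mean power2_eq_square)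
  finally show "ennreal (5/216) \<le> overlap a" .
qed

lemma distortion_integrand_measurable:
  assumes "finite \<alpha>"
  shows "(\<lambda>x. ennreal ((Min ((\<lambda>a. norm (x - a)) ` \<alpha>))\<^sup>2)) \<in> borel_measurable (borel :: (real \<times> real) measure)"
proof -
  have [measurable]: "(\<lambda>x. Min ((\<lambda>a. norm (x - a)) ` \<alpha>)) \<in> borel_measurable (borel :: (real \<times> real) measure)"
    using assms by (intro borel_measurable_Min) auto
  show ?thesis by measurable
qed

lemma sets_tri_uniform [measurable_cong]: "sets tri_uniform = sets borel"
  by (simp add: tri_uniform_def)

section \<open>Weak duality, complementary slackness and uniqueness\<close>

text \<open>Pointwise, the summand of a nearest point of \<alpha> alone covers the certificate; the
  other summands are nonnegative.\<close>

lemma certificate_mean_le: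
  assumes "finite \<alpha>" "\<alpha> \<noteq> {}"
  shows "(\<integral>\<^sup>+x. ennreal (certificate x) \<partial>tri_uniform) \<le> distortion tri_uniform \<alpha> + (\<Sum>a\<in>\<alpha>. overlap a)"
proof -
  note [measurable] = distortion_integrand_measurable[OF assms(1)]
  have "(\<integral>\<^sup>+x. ennreal (certificate x) \<partial>tri_uniform)
    \<le> (\<integral>\<^sup>+x. ennreal ((Min ((\<lambda>a. norm (x - a)) ` \<alpha>))\<^sup>2) + (\<Sum>a\<in>\<alpha>. ennreal (certificate x - (norm (x - a))\<^sup>2)) \<partial>tri_uniform)"
  proof (rule nn_integral_mono)
    fix x
    have "Min ((\<lambda>a. norm (x - a)) ` \<alpha>) \<in> (\<lambda>a. norm (x - a)) ` \<alpha>"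
      using assms by (intro Min_in) auto
    then obtain a where a: "a \<in> \<alpha>" "Min ((\<lambda>a. norm (x - a)) ` \<alpha>) = norm (x - a)" by auto
    have "ennreal (certificate x) \<le> ennreal ((norm (x - a))\<^sup>2) + ennreal (certificate x - (norm (x - a))\<^sup>2)"
      by (cases "(norm (x - a))\<^sup>2 \<le> certificate x")
         (auto simp: ennreal_plus[symmetric] ennreal_leI add_increasing2 simp del: ennreal_plus)
    also have "\<dots> \<le> ennreal ((norm (x - a))\<^sup>2) + (\<Sum>a\<in>\<alpha>. ennreal (certificate x - (norm (x - a))\<^sup>2))"
      using a(1) assms(1) by (intro add_left_mono member_le_sum) auto
    finally show "ennreal (certificate x) \<le> ennreal ((Min ((\<lambda>a. norm (x - a)) ` \<alpha>))\<^sup>2) + (\<Sum>a\<in>\<alpha>. ennreal (certificate x - (norm (x - a))\<^sup>2))"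
      by (simp only: a(2))
  qed
  also have "\<dots> = distortion tri_uniform \<alpha> + (\<Sum>a\<in>\<alpha>. overlap a)"
    unfolding distortion_def overlap_def
    by (subst nn_integral_add, measurable) (subst nn_integral_sum, auto)
  finally show ?thesis .
qed

text \<open>Complementary slackness: the center belonging to the largest barycentric coordinate is
  nearest, and the certificate does not exceed the squared distances to the other two. One positive
  part survives and adds up with the squared distance to the certificate.\<close>

lemma certificate_mean_ge:
  shows "distortion tri_uniform centers + (\<Sum>a\<in>centers. overlap a) \<le> (\<integral>\<^sup>+x. ennreal (certificate x) \<partial>tri_uniform)"
proof -
  have fin: "finite centers" by (simp add: centers_def)
  note [measurable] = distortion_integrand_measurable[OF fin]
  let ?h = "\<lambda>x. ennreal ((Min ((\<lambda>a. norm (x - a)) ` centers))\<^sup>2) + (\<Sum>a\<in>centers. ennreal (certificate x - (norm (x - a))\<^sup>2))"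
  have [measurable]: "?h \<in> borel_measurable borel" by measurable
  have bound: "?h p \<le> ennreal (certificate p)"
    if "a \<in> centers" "certificate p - (norm (p - a))\<^sup>2 \<ge> 0" "\<And>b. b \<in> centers \<Longrightarrow> b \<noteq> a \<Longrightarrow> certificate p - (norm (p - b))\<^sup>2 \<le> 0" for p a
  proof -
    have "(\<Sum>a\<in>centers. ennreal (certificate p - (norm (p - a))\<^sup>2)) = (\<Sum>b\<in>{a}. ennreal (certificate p - (norm (p - b))\<^sup>2))"
      using that by (intro sum.mono_neutral_right fin) (auto simp: ennreal_neg)
    moreover have "(Min ((\<lambda>a. norm (p - a)) ` centers))\<^sup>2 \<le> (norm (p - a))\<^sup>2"
      using that(1) fin by (intro power_mono) (auto simp: Min_ge_iff centers_def)
    ultimately have "?h p \<le> ennreal ((norm (p - a))\<^sup>2) + ennreal (certificate p - (norm (p - a))\<^sup>2)"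
      by (simp add: ennreal_leI add_right_mono)
    also have "\<dots> = ennreal (certificate p)"
      using that(2) by (subst ennreal_plus[symmetric]) auto
    finally show ?thesis .
  qed
  have "distortion tri_uniform centers + (\<Sum>a\<in>centers. overlap a) = (\<integral>\<^sup>+x. ?h x \<partial>tri_uniform)"
    unfolding distortion_def overlap_def
    by (subst nn_integral_add, measurable) (subst nn_integral_sum, auto)
  also have "\<dots> = simplex_mean (\<lambda>x y z. ?h (y + z / 2, sqrt 3 / 2 * z))"
    by (rule nn_integral_tri_uniform) measurable
  also have "\<dots> \<le> simplex_mean (\<lambda>x y z. ennreal (certificate (y + z / 2, sqrt 3 / 2 * z)))"
  proof (rule simplex_mean_mono)
    fix x y z :: real
    assume *: "0 \<le> x" "0 \<le> y" "0 \<le> z" "x + y + z = 1"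
    let ?p = "(y + z / 2, sqrt 3 / 2 * z)"
    have diff:
      "certificate ?p - (norm (?p - (7/24, 7 / (24 * sqrt 3))))\<^sup>2 = 5/24 * (x - y - z + min x (min y z))"
      "certificate ?p - (norm (?p - (17/24, 7 / (24 * sqrt 3))))\<^sup>2 = 5/24 * (y - x - z + min x (min y z))"
      "certificate ?p - (norm (?p - (1/2, 11 / (12 * sqrt 3))))\<^sup>2 = 5/24 * (z - x - y + min x (min y z))"
      unfolding certificate_minus_square[OF *(4)] by (simp_all add: power2_eq_square)
    consider "y \<le> x" "z \<le> x" | "x \<le> y" "z \<le> y" | "x \<le> z" "y \<le> z" by linarith
    moreover have min: "min x (min y z) \<le> x" "min x (min y z) \<le> y" "min x (min y z) \<le> z"
      "min x (min y z) = x \<or> min x (min y z) = y \<or> min x (min y z) = z"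
      by (auto simp: min_def)
    ultimately show "?h ?p \<le> ennreal (certificate ?p)"
    proof cases
      case 1
      show ?thesis
      proof (rule bound[of "(7/24, 7 / (24 * sqrt 3))"])
        show "0 \<le> certificate ?p - (norm (?p - (7/24, 7 / (24 * sqrt 3))))\<^sup>2"
          unfolding diff using 1 min * by auto
        fix b assume "b \<in> centers" "b \<noteq> (7/24, 7 / (24 * sqrt 3))"
        then consider "b = (17/24, 7 / (24 * sqrt 3))" | "b = (1/2, 11 / (12 * sqrt 3))"
          unfolding centers_def by blast
        then show "certificate ?p - (norm (?p - b))\<^sup>2 \<le> 0"
          by cases (simp_all only: diff, use 1 min * in auto)
      qed (simp add: centers_def)
    next
      case 2
      show ?thesis
      proof (rule bound[of "(17/24, 7 / (24 * sqrt 3))"])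
        show "0 \<le> certificate ?p - (norm (?p - (17/24, 7 / (24 * sqrt 3))))\<^sup>2"
          unfolding diff using 2 min * by auto
        fix b assume "b \<in> centers" "b \<noteq> (17/24, 7 / (24 * sqrt 3))"
        then consider "b = (7/24, 7 / (24 * sqrt 3))" | "b = (1/2, 11 / (12 * sqrt 3))"
          unfolding centers_def by blast
        then show "certificate ?p - (norm (?p - b))\<^sup>2 \<le> 0"
          by cases (simp_all only: diff, use 2 min * in auto)
      qed (simp add: centers_def)
    next
      case 3
      show ?thesis
      proof (rule bound[of "(1/2, 11 / (12 * sqrt 3))"])
        show "0 \<le> certificate ?p - (norm (?p - (1/2, 11 / (12 * sqrt 3))))\<^sup>2"
          unfolding diff using 3 min * by auto
        fix b assume "b \<in> centers" "b \<noteq> (1/2, 11 / (12 * sqrt 3))"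
        then consider "b = (7/24, 7 / (24 * sqrt 3))" | "b = (17/24, 7 / (24 * sqrt 3))"
          unfolding centers_def by blast
        then show "certificate ?p - (norm (?p - b))\<^sup>2 \<le> 0"
          by cases (simp_all only: diff, use 3 min * in auto)
      qed (simp add: centers_def)
    qed
  qed
  also have "\<dots> = (\<integral>\<^sup>+x. ennreal (certificate x) \<partial>tri_uniform)"
    by (rule nn_integral_tri_uniform[symmetric]) measurable
  finally show ?thesis .
qed

text \<open>Only finiteness matters, since it permits cancellation in \<open>ennreal\<close>; the
  constants are crude.\<close>

lemma certificate_mean_finite: "(\<integral>\<^sup>+x. ennreal (certificate x) \<partial>tri_uniform) < \<infinity>"
proof -
  have "(\<integral>\<^sup>+x. ennreal (certificate x) \<partial>tri_uniform) = simplex_mean (\<lambda>x y z. ennreal (certificate (y + z / 2, sqrt 3 / 2 * z)))"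
    by (rule nn_integral_tri_uniform) measurable
  also have "\<dots> \<le> affine_mean 10 10 10"
    unfolding affine_mean_def
  proof (rule simplex_mean_mono, rule ennreal_leI)
    fix x y z :: real
    assume *: "0 \<le> x" "0 \<le> y" "0 \<le> z" "x + y + z = 1"
    let ?p = "(y + z / 2, sqrt 3 / 2 * z)"
    have "certificate ?p - (norm (?p - (7/24, 7 / (24 * sqrt 3))))\<^sup>2 = 5/24 * (x - y - z + min x (min y z))"
      unfolding certificate_minus_square[OF *(4)] by (simp add: power2_eq_square)
    moreover have "min x (min y z) \<le> x" by simp
    moreover have "(norm (?p - (7/24, 7 / (24 * sqrt 3))))\<^sup>2 \<le> 5"
    proof -
      have c: "7 / (24 * sqrt 3) = 7 / 72 * sqrt 3"
        by (simp add: field_simps)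
      have "(norm (?p - (7/24, 7 / (24 * sqrt 3))))\<^sup>2 = (y + z / 2 - 7/24)\<^sup>2 + (sqrt 3 / 2 * z - 7 / 72 * sqrt 3)\<^sup>2"
        unfolding c by (simp add: norm_Pair)
      also have "(sqrt 3 / 2 * z - 7 / 72 * sqrt 3)\<^sup>2 = (sqrt 3)\<^sup>2 * (z / 2 - 7/72)\<^sup>2"
        unfolding power_mult_distrib[symmetric] by (simp add: algebra_simps)
      also have "(sqrt 3)\<^sup>2 = 3" by simp
      finally have "(norm (?p - (7/24, 7 / (24 * sqrt 3))))\<^sup>2 = (y + z / 2 - 7/24)\<^sup>2 + 3 * (z / 2 - 7/72)\<^sup>2" .
      moreover have "(y + z / 2 - 7/24)\<^sup>2 \<le> 1" "(z / 2 - 7/72)\<^sup>2 \<le> 1"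
        using * by (auto simp: abs_square_le_1 abs_le_iff)
      ultimately show ?thesis by linarith
    qed
    moreover have "c \<le> 10 * x + 10 * y + 10 * z" if "c - n = 5/24 * (x - y - z + m)" "m \<le> x" "n \<le> 5" for c n m
      using that * by argo
    ultimately show "certificate ?p \<le> 10 * x + 10 * y + 10 * z"
      by blast
  qed
  also have "\<dots> \<le> ennreal ((max 0 10 + max 0 10 + max 0 10) / 3)" by (rule affine_mean_vertices)
  also have "\<dots> < \<infinity>" by simp
  finally show ?thesis .
qed

text \<open>Either \<alpha> is a proper subset of the centers and has fewer than three summands, or
  it contains a point whose overlap is strictly below the maximum 5/216. The sums are compared in
  the reals.\<close>

lemma sum_overlap_less:
  assumes "finite \<alpha>" "card \<alpha> \<le> 3" "\<alpha> \<noteq> centers"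
  shows "(\<Sum>a\<in>\<alpha>. overlap a) < (\<Sum>a\<in>centers. overlap a)"
proof -
  define o' where "o' a = enn2real (overlap a)" for a
  have o': "overlap a = ennreal (o' a)" for a
    using overlap_le(2)[of a] unfolding o'_def by (metis ennreal_enn2real ennreal_less_top le_less_trans)
  have nonneg: "0 \<le> o' a" for a by (simp add: o'_def)
  have le: "o' a \<le> 5/216" for a
    using overlap_le(2)[of a] unfolding o' by simp
  have less: "o' a < 5/216" if "a \<notin> centers" for a
    using overlap_le(1)[of a] that unfolding o' centers_def by (simp add: ennreal_less_iff nonneg)
  have eq: "o' a = 5/216" if "a \<in> centers" for a
    using overlap_centers[of a] that nonneg[of a] unfolding o' centers_def by (simp add: ennreal_inj)
  have card: "finite centers" "card centers = 3" by (simp_all add: centers_def)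
  have "sum o' \<alpha> < 5/72"
  proof (cases "\<alpha> \<subseteq> centers")
    case True
    then have "card \<alpha> < 3" using card assms(3) by (metis psubset_card_mono psubsetI)
    moreover have "sum o' \<alpha> \<le> real (card \<alpha>) * (5/216)" by (intro sum_bounded_above le)
    ultimately show ?thesis by linarith
  next
    case False
    then have "\<exists>a\<in>\<alpha>. o' a < 5/216" using less by blast
    then have "sum o' \<alpha> < (\<Sum>a\<in>\<alpha>. 5/216)" using assms(1) le by (intro sum_strict_mono_ex1) auto
    also have "\<dots> \<le> 5/72" using assms(2) by simp
    finally show ?thesis .
  qed
  also have "5/72 = (\<Sum>a\<in>centers. 5/216 :: real)" using card by simp
  also have "\<dots> = sum o' centers" by (intro sum.cong) (simp_all add: eq)
  finally show ?thesis
    unfolding o' by (simp add: sum_ennreal nonneg sum_nonneg ennreal_less_iff)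
qed

text \<open>Error plus total overlap is at most the certificate mean for the centers and at least
  that mean for any competitor. A competitor has strictly smaller total overlap, hence strictly
  larger error.\<close>

lemma optimal_set_iff_centers: "optimal_set tri_uniform 3 \<alpha> \<longleftrightarrow> \<alpha> = centers"
proof -
  let ?V = "distortion tri_uniform"
  let ?S = "\<lambda>\<alpha>. \<Sum>a\<in>\<alpha>. overlap a"
  let ?G = "\<integral>\<^sup>+x. ennreal (certificate x) \<partial>tri_uniform"
  have ge: "?V centers + ?S centers \<le> ?G"
    by (rule certificate_mean_ge)
  then have fin: "?V centers \<noteq> \<infinity>"
    using certificate_mean_finite by (auto simp: top_unique)
  have adm: "admissible 3 centers"
    by (auto simp: admissible_def centers_def card_insert_if)
  have less: "?V centers < ?V \<alpha>" if "admissible 3 \<alpha>" "\<alpha> \<noteq> centers" for \<alpha>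
  proof (rule ccontr)
    assume "\<not> ?V centers < ?V \<alpha>"
    have "?V centers + ?S centers \<le> ?V \<alpha> + ?S \<alpha>"
      using ge certificate_mean_le[of \<alpha>] that(1) by (auto simp: admissible_def)
    also have "\<dots> \<le> ?V centers + ?S \<alpha>"
      using \<open>\<not> ?V centers < ?V \<alpha>\<close> by (intro add_right_mono) simp
    finally have "?S centers \<le> ?S \<alpha>" using fin by (simp add: ennreal_add_left_cancel_le)
    moreover have "?S \<alpha> < ?S centers"
      using that by (intro sum_overlap_less) (auto simp: admissible_def)
    ultimately show False by simp
  qed
  have q: "quant_error tri_uniform 3 = ?V centers"
    unfolding quant_error_def
  proof (rule antisym)
    show "(INF \<alpha>\<in>{\<alpha>. admissible 3 \<alpha>}. ?V \<alpha>) \<le> ?V centers" using adm by (intro INF_lower) simp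
    show "?V centers \<le> (INF \<alpha>\<in>{\<alpha>. admissible 3 \<alpha>}. ?V \<alpha>)" using less by (intro INF_greatest) (metis mem_Collect_eq order.refl less_imp_le)
  qed
  show ?thesis
    unfolding optimal_set_def q using adm less by (metis less_irrefl)
qed

lemma dist_centers:
  defines "a1 \<equiv> (7/24, 7 / (24 * sqrt 3)) :: real \<times> real"
    and "a2 \<equiv> (17/24, 7 / (24 * sqrt 3)) :: real \<times> real"
    and "a3 \<equiv> (1/2, 11 / (12 * sqrt 3)) :: real \<times> real"
  shows "dist a1 a2 = dist a2 a3 \<and> dist a2 a3 = dist a3 a1"
proof -
  have "7 / (24 * sqrt 3) = 7/72 * sqrt 3" "11 / (12 * sqrt 3) = 11/36 * sqrt 3"
    by (simp_all add: field_simps)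
  moreover have "(7/72 * q - 11/36 * q)\<^sup>2 = q\<^sup>2 * (25/576)" "(11/36 * q - 7/72 * q)\<^sup>2 = q\<^sup>2 * (25/576)" for q :: real
    by (simp_all add: power2_eq_square)
  note this[of "sqrt 3"]
  ultimately show ?thesis
    unfolding a1_def a2_def a3_def dist_Pair_Pair dist_real_def by (simp add: power2_eq_square)
qed

lemma parallel_centers:
  "parallel ((17/24, 7 / (24 * sqrt 3)) - (7/24, 7 / (24 * sqrt 3))) ((1,0) - (0,0))"
  "parallel ((1/2, 11 / (12 * sqrt 3)) - (7/24, 7 / (24 * sqrt 3))) ((1/2, sqrt 3 / 2) - (0,0))"
  "parallel ((1/2, 11 / (12 * sqrt 3)) - (17/24, 7 / (24 * sqrt 3))) ((1/2, sqrt 3 / 2) - (1,0))"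
proof -
  have "11 / (12 * sqrt 3) - 7 / (24 * sqrt 3) = 5/24 * sqrt 3"
    by (simp add: field_simps)
  then show
    "parallel ((17/24, 7 / (24 * sqrt 3)) - (7/24, 7 / (24 * sqrt 3))) ((1,0) - (0,0))"
    "parallel ((1/2, 11 / (12 * sqrt 3)) - (7/24, 7 / (24 * sqrt 3))) ((1/2, sqrt 3 / 2) - (0,0))"
    "parallel ((1/2, 11 / (12 * sqrt 3)) - (17/24, 7 / (24 * sqrt 3))) ((1/2, sqrt 3 / 2) - (1,0))"
    \<comment> \<open>The triangle of centers has side 17/24 - 7/24 = 5/12, and the original one has
      side 1.\<close>
    unfolding parallel_def by (intro exI[of _ "5/12"]; simp)+
qed

theorem theorem4p1:
  defines "a1 \<equiv> (7/24, 7 / (24 * sqrt 3)) :: real \<times> real"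
    and "a2 \<equiv> (17/24, 7 / (24 * sqrt 3)) :: real \<times> real"
    and "a3 \<equiv> (1/2, 11 / (12 * sqrt 3)) :: real \<times> real"
  shows "(\<forall>\<alpha>. optimal_set tri_uniform 3 \<alpha> \<longleftrightarrow> \<alpha> = {a1, a2, a3})
    \<and> dist a1 a2 = dist a2 a3 \<and> dist a2 a3 = dist a3 a1
    \<and> parallel (a2 - a1) ((1,0) - (0,0))
    \<and> parallel (a3 - a1) ((1/2, sqrt 3 / 2) - (0,0))
    \<and> parallel (a3 - a2) ((1/2, sqrt 3 / 2) - (1,0))"
  unfolding a1_def a2_def a3_def
  using optimal_set_iff_centers[unfolded centers_def] dist_centers parallel_centers by blast

end
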